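(* Let $\Omega\subseteq\mathbb{R}^d$ and let $M_i=(\Omega,P_i)$, $i\in[L]=\{1,\dots,L\}$, be reversible Markov chains with stationary distributions $p_i$ (with densities, also denoted $p_i$). Let $r_1,\dots,r_L>0$ with $\sum_i r_i=1$, let $r=\min_i r_i/\max_i r_i$, and let $M_{\mathrm{st}}$ be the simulated tempering chain built from $(M_i)$ and $(r_i)$. For each $i\in[L]$ let $\mathcal P_i$ be a finite partition of $\Omega$ into measurable sets (overlaps of measure zero allowed) with $p_i(A)>0$ for all $A\in\mathcal P_i$, and with $\mathcal P_1=\{\Omega\}$. Let $$\delta=\min_{1<i\le L,\ A\in\mathcal P_i}\frac{\int_A\min\{p_{i-1}(x),p_i(x)\}\,dx}{p_i(A)},\qquad p_{\min}=\min_{i\in[L],\,A\in\mathcal P_i}p_i(A).$$ Then $$\operatorname{Gap}(M_{\mathrm{st}})\ \ge\ \frac{r^4\delta^2p_{\min}^2}{32L^4}\min_{1\le i\le L,\ A\in\mathcal P_i}\operatorname{Gap}(M_i|_A).$$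
   Context: A (discrete-time) Markov chain $M=(\Omega,P)$ has transition kernel $P(x,\cdot)$; $p$ is stationary if $\int p(x)P(x,\cdot)dx=p$, and $M$ is reversible if $p(x)P(x,dy)=p(y)P(y,dx)$. For $g\in L^2(p)$, $(Pg)(x)=\int g(y)P(x,dy)$, $\langle g,h\rangle_p=\int gh\,p$, the Dirichlet form is $\mathcal E_M(g)=\langle g,(I-P)g\rangle_p$, $\operatorname{Var}_p(g)=\|g-\int gp\|_p^2$, and the spectral gap is $\operatorname{Gap}(M)=\inf\{\mathcal E_M(g)/\operatorname{Var}_p(g): g\in L^2(p),\ \operatorname{Var}_p(g)>0\}$. Restriction: for measurable $A\subseteq\Omega$, $M|_A=(A,P|_A)$ with $P|_A(x,B)=P(x,B)+\mathbf 1_B(x)P(x,A^c)$ for $x\in A$, $B\subseteq A$ (proposed moves leaving $A$ are rejected); its stationary distribution is $p$ conditioned on $A$. Simulated tempering chain: state space $\Omega\times[L]$. From state $(x,k)$: with probability $1/2$ (Type 1) keep $k$ and move $x$ according to $P_k$; with probability $1/2$ (Type 2) draw $k'$ uniformly from $[L]$ and move to $(x,k')$ with probability $\min\{\frac{r_{k'}p_{k'}(x)}{r_kp_k(x)},1\}$, otherwise stay. Its stationary distribution is $p(x,i)=r_ip_i(x)$. *)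

theory Defs
  imports "HOL-Probability.Probability"
begin

text \<open>A Markov chain on the state space  space mu  is a kernel K sending each state x to a
probability measure  K x  on mu (i.e. K x B = P(x,B)).  Its distribution is given by a density q
w.r.t. the reference measure mu.\<close>

definition markov_kernel :: "'b measure \<Rightarrow> ('b \<Rightarrow> 'b measure) \<Rightarrow> bool" where
  "markov_kernel mu K \<longleftrightarrow> K \<in> mu \<rightarrow>\<^sub>M prob_algebra mu"

definition prob_density :: "'b measure \<Rightarrow> ('b \<Rightarrow> real) \<Rightarrow> bool" where
  "prob_density mu q \<longleftrightarrow> q \<in> borel_measurable mu \<and> (\<forall>x\<in>space mu. 0 \<le> q x)
     \<and> integrable mu q \<and> (\<integral>x. q x \<partial>mu) = 1"

definition stationary :: "'b measure \<Rightarrow> ('b \<Rightarrow> real) \<Rightarrow> ('b \<Rightarrow> 'b measure) \<Rightarrow> bool" where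
  "stationary mu q K \<longleftrightarrow>
     (\<forall>B\<in>sets mu. (\<integral>x. q x * measure (K x) B \<partial>mu) = (\<integral>x. indicator B x * q x \<partial>mu))"

text \<open>Reversibility  q(x) P(x,dy) dx = q(y) P(y,dx) dy,  tested on rectangles A x B.\<close>
definition reversible :: "'b measure \<Rightarrow> ('b \<Rightarrow> real) \<Rightarrow> ('b \<Rightarrow> 'b measure) \<Rightarrow> bool" where
  "reversible mu q K \<longleftrightarrow>
     (\<forall>A\<in>sets mu. \<forall>B\<in>sets mu.
        (\<integral>x. indicator A x * q x * measure (K x) B \<partial>mu)
      = (\<integral>x. indicator B x * q x * measure (K x) A \<partial>mu))"

definition L2 :: "'b measure \<Rightarrow> ('b \<Rightarrow> real) \<Rightarrow> ('b \<Rightarrow> real) \<Rightarrow> bool" where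
  "L2 mu q g \<longleftrightarrow> g \<in> borel_measurable mu \<and> integrable mu (\<lambda>x. (g x)\<^sup>2 * q x)"

definition dirichlet_form ::
  "'b measure \<Rightarrow> ('b \<Rightarrow> real) \<Rightarrow> ('b \<Rightarrow> 'b measure) \<Rightarrow> ('b \<Rightarrow> real) \<Rightarrow> real" where
  "dirichlet_form mu q K g = (\<integral>x. g x * (g x - (\<integral>y. g y \<partial>(K x))) * q x \<partial>mu)"

definition var_pi :: "'b measure \<Rightarrow> ('b \<Rightarrow> real) \<Rightarrow> ('b \<Rightarrow> real) \<Rightarrow> real" where
  "var_pi mu q g = (\<integral>x. (g x - (\<integral>y. g y * q y \<partial>mu))\<^sup>2 * q x \<partial>mu)"

definition spectral_gap :: "'b measure \<Rightarrow> ('b \<Rightarrow> real) \<Rightarrow> ('b \<Rightarrow> 'b measure) \<Rightarrow> real" where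
  "spectral_gap mu q K =
     Inf {dirichlet_form mu q K g / var_pi mu q g | g. L2 mu q g \<and> var_pi mu q g > 0}"

definition restrict_kernel :: "'b measure \<Rightarrow> ('b \<Rightarrow> 'b measure) \<Rightarrow> 'b set \<Rightarrow> 'b \<Rightarrow> 'b measure" where
  "restrict_kernel mu K A x = measure_of A (sets (restrict_space mu A))
     (\<lambda>B. emeasure (K x) B + indicator B x * emeasure (K x) (space mu - A))"

definition mass :: "'b measure \<Rightarrow> ('b \<Rightarrow> real) \<Rightarrow> 'b set \<Rightarrow> real" where
  "mass mu q A = (\<integral>x. indicator A x * q x \<partial>mu)"

text \<open>Spectral gap of the restricted chain M|_A, whose stationary distribution is q conditioned on A.\<close>
definition restricted_gap :: "'b measure \<Rightarrow> ('b \<Rightarrow> real) \<Rightarrow> ('b \<Rightarrow> 'b measure) \<Rightarrow> 'b set \<Rightarrow> real" where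
  "restricted_gap mu q K A =
     spectral_gap (restrict_space mu A) (\<lambda>x. q x / mass mu q A) (restrict_kernel mu K A)"

definition state_space :: "'a::euclidean_space set \<Rightarrow> 'a measure" where
  "state_space \<Omega> = restrict_space lborel \<Omega>"

definition is_partition :: "'a::euclidean_space set \<Rightarrow> 'a set set \<Rightarrow> bool" where
  "is_partition \<Omega> PP \<longleftrightarrow> finite PP \<and> (\<forall>A\<in>PP. A \<in> sets lborel \<and> A \<subseteq> \<Omega>) \<and> \<Union>PP = \<Omega>
     \<and> (\<forall>A\<in>PP. \<forall>B\<in>PP. A \<noteq> B \<longrightarrow> emeasure lborel (A \<inter> B) = 0)"

definition st_space :: "'a::euclidean_space set \<Rightarrow> nat \<Rightarrow> ('a \<times> nat) measure" where
  "st_space \<Omega> L = state_space \<Omega> \<Otimes>\<^sub>M count_space {1..L}"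

definition st_density :: "(nat \<Rightarrow> 'a \<Rightarrow> real) \<Rightarrow> (nat \<Rightarrow> real) \<Rightarrow> 'a \<times> nat \<Rightarrow> real" where
  "st_density p r = (\<lambda>(x, i). r i * p i x)"

definition st_accept :: "(nat \<Rightarrow> 'a \<Rightarrow> real) \<Rightarrow> (nat \<Rightarrow> real) \<Rightarrow> 'a \<Rightarrow> nat \<Rightarrow> nat \<Rightarrow> real" where
  "st_accept p r x k k' = min ((r k' * p k' x) / (r k * p k x)) 1"

text \<open>Transition kernel: with prob 1/2 move x by P_k; with prob 1/2 pick k' uniformly in [L]
and move to (x,k') with the acceptance probability, otherwise stay.\<close>
definition st_kernel ::
  "'a::euclidean_space set \<Rightarrow> nat \<Rightarrow> (nat \<Rightarrow> 'a \<Rightarrow> 'a measure) \<Rightarrow> (nat \<Rightarrow> 'a \<Rightarrow> real)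
     \<Rightarrow> (nat \<Rightarrow> real) \<Rightarrow> 'a \<times> nat \<Rightarrow> ('a \<times> nat) measure" where
  "st_kernel \<Omega> L P p r = (\<lambda>(x, k). measure_of (space (st_space \<Omega> L)) (sets (st_space \<Omega> L))
     (\<lambda>B. (1/2) * emeasure (P k x) {y \<in> \<Omega>. (y, k) \<in> B}
        + (\<Sum>k'\<in>{1..L}. ennreal ((1 / (2 * real L)) *
             (st_accept p r x k k' * indicator B (x, k')
              + (1 - st_accept p r x k k') * indicator B (x, k))))))"

end

theory Submission
  imports Defs
begin

text \<open>
  By stationarity, twice the Dirichlet form is the integral of (g(x) - g(y))^2 against q(x) K(x,dy).
  For the tempering chain this dominates both the block energies of the chains on the single levels,
  hence (through the restricted gaps) the deviations of g from its block means m(i,A), and the squared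
  increments of g between adjacent levels, weighted by the overlap min(p_(i-1), p_i).  For a block A
  on level i, comparing the mean of these three local costs over A with the overlap mass of A, which
  is at least \<delta> pmin, gives a block B on level i - 1 whose mean m(i-1,B) is close to m(i,A).  Following
  such blocks down to the single block \<Omega> on level 1 in at most L - 1 steps and applying the
  Cauchy-Schwarz inequality bounds (m(i,A) - m(1,\<Omega>))^2, and therefore the variance of g.  The restricted
  gap is at most 2 since distributions with a Lebesgue density are not concentrated in a point.
\<close>

section \<open>Dirichlet form and energy\<close>

text \<open>Stationarity and energies are stated with \<open>ennreal\<close> integrals, so that
  kernels can be mixed, restricted and split into blocks before any integrability is known; real
  numbers return once finiteness follows from the finite Dirichlet form. The between-level cost
  enters the energy without the factor \<gamma> that the within-block cost carries. This is why an
  upper bound on the restricted gap is needed: with \<gamma> \<le> 2 both costs can be charged to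
  the same multiple of the Dirichlet form. A real \<open>Inf\<close> is informative only for
  nonempty sets that are bounded below, so nonnegativity of the Dirichlet form and a nonconstant
  test function must be supplied. The argument yields \<delta>, pmin and the smallest weight to the
  first power, with a constant of order L^2. The weight is then traded for rr at the price of one
  factor L, and the higher powers in the theorem only weaken the bound, since these quantities lie
  in [0, 1].\<close>

definition nn_stationary :: "'b measure \<Rightarrow> ('b \<Rightarrow> real) \<Rightarrow> ('b \<Rightarrow> 'b measure) \<Rightarrow> bool" where
  "nn_stationary mu q K \<longleftrightarrow> (\<forall>f\<in>borel_measurable mu.
     (\<integral>\<^sup>+x. ennreal (q x) * (\<integral>\<^sup>+y. f y \<partial>K x) \<partial>mu) = (\<integral>\<^sup>+x. ennreal (q x) * f x \<partial>mu))"

definition energy :: "'b measure \<Rightarrow> ('b \<Rightarrow> real) \<Rightarrow> ('b \<Rightarrow> 'b measure) \<Rightarrow> ('b \<Rightarrow> real) \<Rightarrow> ennreal" where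
  "energy mu q K g = (\<integral>\<^sup>+x. ennreal (q x) * (\<integral>\<^sup>+y. ennreal ((g x - g y)\<^sup>2) \<partial>K x) \<partial>mu)"

lemma markov_kernelD:
  assumes "markov_kernel mu K"
  shows "K \<in> mu \<rightarrow>\<^sub>M subprob_algebra mu"
    and "x \<in> space mu \<Longrightarrow> prob_space (K x)"
    and "x \<in> space mu \<Longrightarrow> sets (K x) = sets mu"
    and "x \<in> space mu \<Longrightarrow> space (K x) = space mu"
proof -
  have K: "K \<in> mu \<rightarrow>\<^sub>M prob_algebra mu" using assms by (simp add: markov_kernel_def)
  then show "K \<in> mu \<rightarrow>\<^sub>M subprob_algebra mu" by (rule measurable_prob_algebraD)
  assume "x \<in> space mu"
  then have "K x \<in> space (prob_algebra mu)" using K by (rule measurable_space[rotated])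
  then show "prob_space (K x)" "sets (K x) = sets mu" by (auto simp: space_prob_algebra)
  then show "space (K x) = space mu" using sets_eq_imp_space_eq by blast
qed

lemma prob_densityD:
  assumes "prob_density mu q"
  shows "q \<in> borel_measurable mu" "x \<in> space mu \<Longrightarrow> 0 \<le> q x" "integrable mu q"
    "(\<integral>x. q x \<partial>mu) = 1" "(\<integral>\<^sup>+x. ennreal (q x) \<partial>mu) = 1"
proof -
  show "q \<in> borel_measurable mu" "x \<in> space mu \<Longrightarrow> 0 \<le> q x" "integrable mu q"
    "(\<integral>x. q x \<partial>mu) = 1" using assms by (auto simp: prob_density_def)
  have "(\<integral>\<^sup>+x. ennreal (q x) \<partial>mu) = ennreal (\<integral>x. q x \<partial>mu)"
    using assms by (intro nn_integral_eq_integral) (auto simp: prob_density_def)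
  then show "(\<integral>\<^sup>+x. ennreal (q x) \<partial>mu) = 1" using assms by (simp add: prob_density_def)
qed

text \<open>Write G = K g and S = K (g^2). Integrating (g x - g y)^2 over y gives 2 g (g - G) + (S -
  g^2), and the bracket has q-integral 0 by stationarity applied to g^2.\<close>

lemma energy_eq_dirichlet_form:
  assumes K: "markov_kernel mu K" and q: "prob_density mu q"
    and stat: "nn_stationary mu q K" and g: "L2 mu q g"
  shows "energy mu q K g = ennreal (2 * dirichlet_form mu q K g)"
    and "0 \<le> dirichlet_form mu q K g"
proof -
  note Km[measurable] = markov_kernelD(1)[OF K]
  note qm[measurable] = prob_densityD(1)[OF q]
  have gm[measurable]: "g \<in> borel_measurable mu" and g2: "integrable mu (\<lambda>x. (g x)\<^sup>2 * q x)"
    using g by (auto simp: L2_def)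
  define k where "k x = (\<integral>\<^sup>+y. ennreal ((g y)\<^sup>2) \<partial>K x)" for x
  define G where "G x = (\<integral>y. g y \<partial>K x)" for x
  define S where "S x = (\<integral>y. (g y)\<^sup>2 \<partial>K x)" for x
  have [measurable]: "k \<in> borel_measurable mu" "G \<in> borel_measurable mu" "S \<in> borel_measurable mu"
    unfolding k_def G_def S_def
    by (auto intro!: measurable_compose[OF Km] nn_integral_measurable_subprob_algebra
        integral_measurable_subprob_algebra)
  have kint: "(\<integral>\<^sup>+x. ennreal (q x) * k x \<partial>mu) = ennreal (\<integral>x. (g x)\<^sup>2 * q x \<partial>mu)"
  proof -
    have "(\<lambda>x. ennreal ((g x)\<^sup>2)) \<in> borel_measurable mu" by measurable
    then have "(\<integral>\<^sup>+x. ennreal (q x) * k x \<partial>mu) = (\<integral>\<^sup>+x. ennreal (q x) * ennreal ((g x)\<^sup>2) \<partial>mu)"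
      using stat unfolding nn_stationary_def k_def by blast
    also have "\<dots> = (\<integral>\<^sup>+x. ennreal ((g x)\<^sup>2 * q x) \<partial>mu)"
      by (intro nn_integral_cong) (simp add: ennreal_mult prob_densityD(2)[OF q] mult.commute)
    also have "\<dots> = ennreal (\<integral>x. (g x)\<^sup>2 * q x \<partial>mu)"
      by (intro nn_integral_eq_integral g2) (auto simp: prob_densityD(2)[OF q])
    finally show ?thesis .
  qed
  have "AE x in mu. ennreal (q x) * k x \<noteq> \<infinity>"
    by (rule nn_integral_PInf_AE) (auto simp: kint)
  \<comment> \<open>Where \<open>k x\<close> is infinite, \<open>S x\<close> is only the default
    value 0 of a divergent Bochner integral. Stationarity for g^2 forces \<open>q x = 0\<close> at
    such points, up to a null set.\<close>
  then have AEk: "AE x in mu. q x = 0 \<or> k x < \<infinity>"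
    by (rule AE_mp) (auto intro!: AE_I2 simp: prob_densityD(2)[OF q] ennreal_mult_eq_top_iff top.not_eq_extremum[symmetric]
          antisym)
  have fin: "ennreal (S x) = k x" "(G x)\<^sup>2 \<le> S x" "0 \<le> (g x)\<^sup>2 - 2 * g x * G x + S x"
     "(\<integral>\<^sup>+y. ennreal ((g x - g y)\<^sup>2) \<partial>K x) = ennreal ((g x)\<^sup>2 - 2 * g x * G x + S x)"
    if x: "x \<in> space mu" and kx: "k x < \<infinity>" for x
  proof -
    interpret Kx: prob_space "K x" using markov_kernelD(2)[OF K x] .
    have [measurable]: "g \<in> borel_measurable (K x)"
      using gm by (simp add: markov_kernelD(3)[OF K x] cong: measurable_cong_sets)
    have i2: "integrable (K x) (\<lambda>y. (g y)\<^sup>2)"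
      using kx by (intro integrableI_nonneg) (auto simp: k_def)
    have i1: "integrable (K x) g" by (rule Kx.square_integrable_imp_integrable[OF _ i2]) measurable
    show "ennreal (S x) = k x" unfolding S_def k_def
      by (rule nn_integral_eq_integral[symmetric, OF i2]) auto
    have quad: "(\<integral>y. (c - g y)\<^sup>2 \<partial>K x) = c\<^sup>2 - 2 * c * G x + S x"
       "integrable (K x) (\<lambda>y. (c - g y)\<^sup>2)" for c
      using i1 i2 by (auto simp: power2_diff G_def S_def Kx.prob_space intro!: Bochner_Integration.integrable_add)
    have nn: "0 \<le> c\<^sup>2 - 2 * c * G x + S x" for c
      unfolding quad(1)[symmetric] by (rule integral_nonneg_AE) auto
    show "0 \<le> (g x)\<^sup>2 - 2 * g x * G x + S x" by (rule nn)
    show "(G x)\<^sup>2 \<le> S x" using nn[of "G x"] by (simp add: power2_eq_square)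
    show "(\<integral>\<^sup>+y. ennreal ((g x - g y)\<^sup>2) \<partial>K x) = ennreal ((g x)\<^sup>2 - 2 * g x * G x + S x)"
      unfolding quad(1)[symmetric] by (rule nn_integral_eq_integral[OF quad(2)]) auto
  qed
  define h where "h x = q x * ((g x)\<^sup>2 - 2 * g x * G x + S x)" for x
  have hnn: "AE x in mu. 0 \<le> h x"
    using AEk AE_space by eventually_elim (auto simp: h_def prob_densityD(2)[OF q] fin)
  have Sq: "AE x in mu. ennreal (S x * q x) = ennreal (q x) * k x"
    using AEk AE_space by eventually_elim (auto simp: ennreal_mult'' prob_densityD(2)[OF q] fin mult.commute)
  have Snn: "0 \<le> S x" for x unfolding S_def by simp
  have Snn': "(\<integral>\<^sup>+x. ennreal (S x * q x) \<partial>mu) = ennreal (\<integral>x. (g x)\<^sup>2 * q x \<partial>mu)"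
    unfolding kint[symmetric] by (rule nn_integral_cong_AE[OF Sq])
  have Si: "integrable mu (\<lambda>x. S x * q x)"
    using Snn' by (intro integrableI_nonneg) (auto simp: Snn prob_densityD(2)[OF q] AE_I2)
  have Sint: "(\<integral>x. S x * q x \<partial>mu) = (\<integral>x. (g x)\<^sup>2 * q x \<partial>mu)"
  proof -
    have "ennreal (\<integral>x. S x * q x \<partial>mu) = (\<integral>\<^sup>+x. ennreal (S x * q x) \<partial>mu)"
      by (rule nn_integral_eq_integral[symmetric, OF Si]) (auto simp: Snn prob_densityD(2)[OF q])
    then show ?thesis unfolding Snn'
      by (subst (asm) ennreal_inj) (auto intro!: integral_nonneg_AE AE_I2 simp: Snn prob_densityD(2)[OF q])
  qed
  \<comment> \<open>The mixed term is dominated through 2 |g G| \<le> g^2 + G^2 and Jensen's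
    inequality G^2 \<le> S, available where \<open>k x\<close> is finite; elsewhere q
    vanishes.\<close>
  have gGi: "integrable mu (\<lambda>x. g x * G x * q x)"
  proof (rule Bochner_Integration.integrable_bound)
    show "integrable mu (\<lambda>x. (g x)\<^sup>2 * q x + S x * q x)" using g2 Si by auto
    show "AE x in mu. norm (g x * G x * q x) \<le> norm ((g x)\<^sup>2 * q x + S x * q x)"
      using AEk AE_space
    proof eventually_elim
      case (elim x)
      show ?case
      proof (cases "q x = 0")
        case False
        then have "(G x)\<^sup>2 \<le> S x" using elim fin by auto
        moreover have "2 * \<bar>g x * G x\<bar> \<le> (g x)\<^sup>2 + (G x)\<^sup>2"
          using sum_squares_bound[of "\<bar>g x\<bar>" "\<bar>G x\<bar>"] by (simp add: abs_mult)
        ultimately have "\<bar>g x * G x\<bar> \<le> (g x)\<^sup>2 + S x" using zero_le_power2[of "g x"] Snn[of x] by linarith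
        then have "\<bar>g x * G x\<bar> * q x \<le> ((g x)\<^sup>2 + S x) * q x"
          using elim prob_densityD(2)[OF q] by (intro mult_right_mono) auto
        then show ?thesis using elim prob_densityD(2)[OF q, of x] Snn[of x]
          by (auto simp: abs_mult ring_distribs)
      qed simp
    qed
  qed measurable
  have di: "integrable mu (\<lambda>x. g x * (g x - G x) * q x)"
    using Bochner_Integration.integrable_diff[OF g2 gGi] by (simp add: power2_eq_square algebra_simps)
  have h_eq: "h = (\<lambda>x. 2 * (g x * (g x - G x) * q x) + (S x * q x - (g x)\<^sup>2 * q x))"
    by (auto simp: h_def power2_eq_square algebra_simps)
  have hi: "integrable mu h" unfolding h_eq using di Si g2 by auto
  have hint: "(\<integral>x. h x \<partial>mu) = 2 * dirichlet_form mu q K g"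
    unfolding h_eq using di Si g2 by (simp add: Sint dirichlet_form_def G_def)
  have "energy mu q K g = (\<integral>\<^sup>+x. ennreal (h x) \<partial>mu)"
    unfolding energy_def
  proof (rule nn_integral_cong_AE)
    show "AE x in mu. ennreal (q x) * (\<integral>\<^sup>+y. ennreal ((g x - g y)\<^sup>2) \<partial>K x) = ennreal (h x)"
      using AEk AE_space
      by eventually_elim (auto simp: h_def ennreal_mult prob_densityD(2)[OF q] fin)
  qed
  also have "\<dots> = ennreal (\<integral>x. h x \<partial>mu)" by (rule nn_integral_eq_integral[OF hi hnn])
  finally show "energy mu q K g = ennreal (2 * dirichlet_form mu q K g)" by (simp add: hint)
  have "0 \<le> (\<integral>x. h x \<partial>mu)" by (rule integral_nonneg_AE[OF hnn])
  then show "0 \<le> dirichlet_form mu q K g" by (simp add: hint)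
qed

lemma L2_mean_integrable:
  assumes q: "prob_density mu q" and g: "L2 mu q g"
  shows "integrable mu (\<lambda>x. g x * q x)"
proof (rule Bochner_Integration.integrable_bound)
  have [measurable]: "g \<in> borel_measurable mu" "q \<in> borel_measurable mu"
    using g prob_densityD(1)[OF q] by (auto simp: L2_def)
  show "integrable mu (\<lambda>x. (g x)\<^sup>2 * q x + q x)"
    using g prob_densityD(3)[OF q] by (auto simp: L2_def)
  show "(\<lambda>x. g x * q x) \<in> borel_measurable mu" by measurable
  show "AE x in mu. norm (g x * q x) \<le> norm ((g x)\<^sup>2 * q x + q x)"
  proof (rule AE_I2)
    fix x assume x: "x \<in> space mu"
    have "\<bar>g x\<bar> \<le> (g x)\<^sup>2 + 1" using sum_squares_bound[of "\<bar>g x\<bar>" 1] by simp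
    then have "\<bar>g x\<bar> * q x \<le> ((g x)\<^sup>2 + 1) * q x"
      using prob_densityD(2)[OF q x] by (intro mult_right_mono) auto
    then show "norm (g x * q x) \<le> norm ((g x)\<^sup>2 * q x + q x)"
      using prob_densityD(2)[OF q x] by (auto simp: abs_mult ring_distribs)
  qed
qed

text \<open>As a function of the centre c the deviation is a quadratic with its minimum at the mean.
  The second claim allows the variance over all levels to be measured from the centre of the base
  block.\<close>

lemma var_pi_eq:
  assumes q: "prob_density mu q" and g: "L2 mu q g"
  shows "ennreal (var_pi mu q g) = (\<integral>\<^sup>+x. ennreal (q x * (g x - (\<integral>y. g y * q y \<partial>mu))\<^sup>2) \<partial>mu)"
    and "ennreal (var_pi mu q g) \<le> (\<integral>\<^sup>+x. ennreal (q x * (g x - c)\<^sup>2) \<partial>mu)"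
    and "0 \<le> var_pi mu q g"
proof -
  let ?m = "\<integral>y. g y * q y \<partial>mu"
  have g2: "integrable mu (\<lambda>x. (g x)\<^sup>2 * q x)" using g by (auto simp: L2_def)
  note g1 = L2_mean_integrable[OF q g]
  note q1 = prob_densityD(3)[OF q]
  have exp: "q x * (g x - c)\<^sup>2 = (g x)\<^sup>2 * q x - 2 * c * (g x * q x) + c\<^sup>2 * q x" for c x
    by (simp add: power2_eq_square algebra_simps)
  have i: "integrable mu (\<lambda>x. q x * (g x - c)\<^sup>2)" for c unfolding exp using g2 g1 q1 by auto
  have v: "(\<integral>x. q x * (g x - c)\<^sup>2 \<partial>mu) = (\<integral>x. (g x)\<^sup>2 * q x \<partial>mu) - 2 * c * ?m + c\<^sup>2" for c
    unfolding exp using g2 g1 q1 by (simp add: prob_densityD(4)[OF q])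
  have nn: "(\<integral>\<^sup>+x. ennreal (q x * (g x - c)\<^sup>2) \<partial>mu) = ennreal (\<integral>x. q x * (g x - c)\<^sup>2 \<partial>mu)" for c
    by (rule nn_integral_eq_integral[OF i]) (auto simp: prob_densityD(2)[OF q])
  have var: "var_pi mu q g = (\<integral>x. q x * (g x - ?m)\<^sup>2 \<partial>mu)"
    by (simp add: var_pi_def mult.commute)
  show "ennreal (var_pi mu q g) = (\<integral>\<^sup>+x. ennreal (q x * (g x - ?m)\<^sup>2) \<partial>mu)"
    by (simp add: var nn)
  show "ennreal (var_pi mu q g) \<le> (\<integral>\<^sup>+x. ennreal (q x * (g x - c)\<^sup>2) \<partial>mu)"
    unfolding var nn v using zero_le_power2[of "c - ?m"]
    by (intro ennreal_leI) (simp add: power2_eq_square algebra_simps)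
  show "0 \<le> var_pi mu q g" unfolding var
    by (rule integral_nonneg_AE) (auto simp: prob_densityD(2)[OF q])
qed

text \<open>Nonnegativity of the Dirichlet form has two uses: it bounds the set of quotients below,
  without which a real \<open>Inf\<close> need not lie below its elements, and it settles functions
  of variance 0, which the infimum does not see.\<close>

lemma poincare_spectral_gap:
  assumes K: "markov_kernel mu K" and q: "prob_density mu q"
    and stat: "nn_stationary mu q K" and g: "L2 mu q g" and c: "c \<le> spectral_gap mu q K"
  shows "c * var_pi mu q g \<le> dirichlet_form mu q K g"
proof (cases "var_pi mu q g > 0")
  case True
  let ?S = "{dirichlet_form mu q K g / var_pi mu q g | g. L2 mu q g \<and> var_pi mu q g > 0}"
  have "bdd_below ?S"
    by (rule bdd_belowI[of _ 0]) (auto intro!: divide_nonneg_pos energy_eq_dirichlet_form(2)[OF K q stat])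
  moreover have "dirichlet_form mu q K g / var_pi mu q g \<in> ?S" using True g by auto
  ultimately have "spectral_gap mu q K \<le> dirichlet_form mu q K g / var_pi mu q g"
    unfolding spectral_gap_def by (intro cInf_lower)
  then show ?thesis using c True by (simp add: pos_le_divide_eq[symmetric])
next
  case False
  then have "var_pi mu q g = 0" using var_pi_eq(3)[OF q g] by simp
  then show ?thesis using energy_eq_dirichlet_form(2)[OF K q stat g] by simp
qed

section \<open>Mixture kernels and restricted chains\<close>

text \<open>The restricted and the tempering kernel are given by a set function under
  \<open>measure_of\<close>, which attains these values only if the function is countably additive.
  Recognising a finite mixture as \<open>bind\<close> over a \<open>point_measure\<close> makes it a
  measure and brings the integration rule of \<open>bind\<close>. The weights c need not add up to
  1.\<close>

lemma measure_of_mixture_eq_bind: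
  fixes N :: "'i \<Rightarrow> 'b measure"
  assumes I: "finite I" "I \<noteq> {}"
    and N: "\<And>i. i \<in> I \<Longrightarrow> subprob_space (N i)" "\<And>i. i \<in> I \<Longrightarrow> sets (N i) = sets M"
    and F: "\<And>B. B \<in> sets M \<Longrightarrow> F B = (\<Sum>i\<in>I. c i * emeasure (N i) B)"
  shows "measure_of (space M) (sets M) F = point_measure I c \<bind> N"
    and "N \<in> point_measure I c \<rightarrow>\<^sub>M subprob_algebra M"
proof -
  show Nm: "N \<in> point_measure I c \<rightarrow>\<^sub>M subprob_algebra M"
    using N by (simp add: measurable_point_measure_eq1 space_subprob_algebra)
  have e: "emeasure (point_measure I c \<bind> N) B = F B" if B: "B \<in> sets M" for B
    using I B F
    by (subst emeasure_bind[OF _ Nm B]) (auto simp: space_point_measure nn_integral_point_measure_finite)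
  have sets: "sets (point_measure I c \<bind> N) = sets M"
    using I N by (intro sets_bind) (auto simp: space_point_measure)
  have space: "space (point_measure I c \<bind> N) = space M" using sets by (rule sets_eq_imp_space_eq)
  have "measure_of (space M) (sets M) F = measure_of (space M) (sets M) (emeasure (point_measure I c \<bind> N))"
    by (rule measure_of_eq) (auto simp: sets.space_closed sets.sigma_sets_eq e)
  also have "\<dots> = point_measure I c \<bind> N"
    using measure_of_of_measure[of "point_measure I c \<bind> N"] by (simp add: sets space)
  finally show "measure_of (space M) (sets M) F = point_measure I c \<bind> N" .
qed

lemma nn_integral_measure_of_mixture:
  fixes N :: "'i \<Rightarrow> 'b measure"
  assumes I: "finite I" "I \<noteq> {}"
    and N: "\<And>i. i \<in> I \<Longrightarrow> subprob_space (N i)" "\<And>i. i \<in> I \<Longrightarrow> sets (N i) = sets M"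
    and F: "\<And>B. B \<in> sets M \<Longrightarrow> F B = (\<Sum>i\<in>I. c i * emeasure (N i) B)"
    and f: "f \<in> borel_measurable M"
  shows "(\<integral>\<^sup>+y. f y \<partial>measure_of (space M) (sets M) F) = (\<Sum>i\<in>I. c i * (\<integral>\<^sup>+y. f y \<partial>N i))"
proof -
  have eq: "measure_of (space M) (sets M) F = point_measure I c \<bind> N"
    by (rule measure_of_mixture_eq_bind(1)) (use I N F in auto)
  have Nm: "N \<in> point_measure I c \<rightarrow>\<^sub>M subprob_algebra M"
    by (rule measure_of_mixture_eq_bind(2)) (use I N F in auto)
  show ?thesis
    by (simp add: eq nn_integral_bind[OF f Nm] nn_integral_point_measure_finite I)
qed

section \<open>Reversibility tested on functions\<close>

lemma markov_kernelI:
  assumes "\<And>x. x \<in> space mu \<Longrightarrow> sets (K x) = sets mu"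
    and "\<And>x. x \<in> space mu \<Longrightarrow> emeasure (K x) (space mu) = 1"
    and "\<And>B. B \<in> sets mu \<Longrightarrow> (\<lambda>x. emeasure (K x) B) \<in> borel_measurable mu"
  shows "markov_kernel mu K"
proof -
  have "prob_space (K x)" if "x \<in> space mu" for x
    using assms(2)[OF that] sets_eq_imp_space_eq[OF assms(1)[OF that]] by (intro prob_spaceI) simp
  then show ?thesis unfolding markov_kernel_def
    by (intro measurable_prob_algebraI measurable_subprob_algebra prob_space_imp_subprob_space assms)
qed

text \<open>For fixed C, the rectangle identity for all B says that two measures agree: the one with
  density 1_C q pushed through K, and the one with density q K(., C). Equal measures integrate every
  nonnegative f equally, so no approximation of functions of two variables is needed.\<close>

lemma reversible_nn_integral:
  assumes K: "markov_kernel mu K" and q: "prob_density mu q" and rev: "reversible mu q K"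
    and C: "C \<in> sets mu" and f: "f \<in> borel_measurable mu"
  shows "(\<integral>\<^sup>+x. indicator C x * ennreal (q x) * (\<integral>\<^sup>+y. f y \<partial>K x) \<partial>mu)
       = (\<integral>\<^sup>+x. ennreal (q x) * emeasure (K x) C * f x \<partial>mu)"
proof -
  note Km[measurable] = markov_kernelD(1)[OF K]
  note qm[measurable] = prob_densityD(1)[OF q]
  note [measurable] = C f
  let ?D = "density mu (\<lambda>x. indicator C x * ennreal (q x))"
  let ?E = "density mu (\<lambda>x. ennreal (q x) * emeasure (K x) C)"
  have em[measurable]: "(\<lambda>x. emeasure (K x) B) \<in> borel_measurable mu"
    "(\<lambda>x. measure (K x) B) \<in> borel_measurable mu" if "B \<in> sets mu" for B
    by (rule measurable_compose[OF Km], use that in measurable)+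
  \<comment> \<open>Over an empty space \<open>bind\<close> takes a default value; the total mass 1
    of q excludes this.\<close>
  have ne: "space mu \<noteq> {}"
  proof
    assume "space mu = {}"
    then have "(\<integral>\<^sup>+x. ennreal (q x) \<partial>mu) = (\<integral>\<^sup>+x. 0 \<partial>mu)" by (intro nn_integral_cong) auto
    then show False using prob_densityD(5)[OF q] by simp
  qed
  have KD: "K \<in> ?D \<rightarrow>\<^sub>M subprob_algebra mu" by measurable
  have real: "(\<integral>\<^sup>+x. indicator X x * ennreal (q x) * emeasure (K x) B \<partial>mu)
      = ennreal (\<integral>x. indicator X x * q x * measure (K x) B \<partial>mu)"
    if X[measurable]: "X \<in> sets mu" and B[measurable]: "B \<in> sets mu" for X B
  proof -
    have "(\<integral>\<^sup>+x. indicator X x * ennreal (q x) * emeasure (K x) B \<partial>mu)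
       = (\<integral>\<^sup>+x. ennreal (indicator X x * q x * measure (K x) B) \<partial>mu)"
    proof (rule nn_integral_cong)
      fix x assume x: "x \<in> space mu"
      interpret prob_space "K x" using markov_kernelD(2)[OF K x] .
      show "indicator X x * ennreal (q x) * emeasure (K x) B = ennreal (indicator X x * q x * measure (K x) B)"
        by (simp add: emeasure_eq_measure ennreal_mult prob_densityD(2)[OF q x] split: split_indicator)
    qed
    also have "\<dots> = ennreal (\<integral>x. indicator X x * q x * measure (K x) B \<partial>mu)"
    proof (rule nn_integral_eq_integral)
      show "integrable mu (\<lambda>x. indicator X x * q x * measure (K x) B)"
      proof (rule Bochner_Integration.integrable_bound[OF prob_densityD(3)[OF q]])
        show "AE x in mu. norm (indicator X x * q x * measure (K x) B) \<le> norm (q x)"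
        proof (rule AE_I2)
          fix x assume x: "x \<in> space mu"
          interpret prob_space "K x" using markov_kernelD(2)[OF K x] .
          show "norm (indicator X x * q x * measure (K x) B) \<le> norm (q x)"
            by (auto simp: abs_mult prob_le_1 mult_left_le split: split_indicator)
        qed
      qed measurable
    qed (auto simp: prob_densityD(2)[OF q])
    finally show ?thesis .
  qed
  have "?D \<bind> K = ?E"
  proof (rule measure_eqI)
    show s: "sets (?D \<bind> K) = sets ?E"
      using ne markov_kernelD(3)[OF K] by (subst sets_bind[of _ _ mu]) auto
    fix B assume "B \<in> sets (?D \<bind> K)"
    then have B[measurable]: "B \<in> sets mu" using s by simp
    have "emeasure (?D \<bind> K) B = (\<integral>\<^sup>+x. indicator C x * ennreal (q x) * emeasure (K x) B \<partial>mu)"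
      using ne by (subst emeasure_bind[OF _ KD B]) (auto simp: nn_integral_density)
    also have "\<dots> = (\<integral>\<^sup>+x. indicator B x * ennreal (q x) * emeasure (K x) C \<partial>mu)"
      using rev C B by (simp add: real reversible_def)
    also have "\<dots> = emeasure ?E B"
      by (subst emeasure_density) (auto intro!: nn_integral_cong simp: ac_simps)
    finally show "emeasure (?D \<bind> K) B = emeasure ?E B" .
  qed
  then have "(\<integral>\<^sup>+x. f x \<partial>(?D \<bind> K)) = (\<integral>\<^sup>+x. f x \<partial>?E)" by simp
  moreover have "(\<lambda>x. \<integral>\<^sup>+y. f y \<partial>K x) \<in> borel_measurable mu"
    by (intro measurable_compose[OF Km] nn_integral_measurable_subprob_algebra f)
  ultimately show ?thesis
    by (simp add: nn_integral_bind[OF f KD] nn_integral_density)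
qed

text \<open>This is the case C = \<open>space mu\<close> of the preceding identity, where every
  \<open>K x\<close> has mass 1.\<close>

lemma reversible_imp_nn_stationary:
  assumes K: "markov_kernel mu K" and q: "prob_density mu q" and rev: "reversible mu q K"
  shows "nn_stationary mu q K"
  unfolding nn_stationary_def
proof
  fix f :: "_ \<Rightarrow> ennreal" assume f: "f \<in> borel_measurable mu"
  have 1: "emeasure (K x) (space mu) = 1" if "x \<in> space mu" for x
    using prob_space.emeasure_space_1[OF markov_kernelD(2)[OF K that]] by (simp add: markov_kernelD(4)[OF K that])
  have "(\<integral>\<^sup>+x. ennreal (q x) * (\<integral>\<^sup>+y. f y \<partial>K x) \<partial>mu)
     = (\<integral>\<^sup>+x. indicator (space mu) x * ennreal (q x) * (\<integral>\<^sup>+y. f y \<partial>K x) \<partial>mu)"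
    by (intro nn_integral_cong) simp
  also have "\<dots> = (\<integral>\<^sup>+x. ennreal (q x) * emeasure (K x) (space mu) * f x \<partial>mu)"
    by (rule reversible_nn_integral[OF K q rev _ f]) simp
  also have "\<dots> = (\<integral>\<^sup>+x. ennreal (q x) * f x \<partial>mu)"
    by (intro nn_integral_cong) (simp add: 1)
  finally show "(\<integral>\<^sup>+x. ennreal (q x) * (\<integral>\<^sup>+y. f y \<partial>K x) \<partial>mu) = (\<integral>\<^sup>+x. ennreal (q x) * f x \<partial>mu)" .
qed

section \<open>The kernel restricted to a block\<close>

lemma nn_integral_restrict_kernel:
  assumes K: "markov_kernel mu K" and A: "A \<in> sets mu" and x: "x \<in> A"
    and f: "f \<in> borel_measurable (restrict_space mu A)"
  shows "(\<integral>\<^sup>+y. f y \<partial>restrict_kernel mu K A x)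
     = (\<integral>\<^sup>+y. f y * indicator A y \<partial>K x) + f x * emeasure (K x) (space mu - A)"
proof -
  have xm: "x \<in> space mu" using A x sets.sets_into_space by blast
  note Kx = markov_kernelD(2-4)[OF K xm]
  interpret prob_space "K x" by (rule Kx(1))
  have sp: "space (restrict_space mu A) = A" using A sets.sets_into_space by (auto simp: space_restrict_space)
  have xr: "x \<in> space (restrict_space mu A)" using sp x by simp
  have AK: "A \<inter> space (K x) \<in> sets (K x)" using A Kx by simp
  have spK: "space (restrict_space (K x) A) = A" using A Kx sets.sets_into_space by (auto simp: space_restrict_space)
  \<comment> \<open>The Boolean index separates accepted from rejected proposals:
    \<open>True\<close> is the part of \<open>K x\<close> inside A, a subprobability of weight 1,
    and \<open>False\<close> is the unit mass at x, weighted with the probability of leaving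
    A.\<close>
  let ?N = "\<lambda>b. if b then restrict_space (K x) A else return (restrict_space mu A) x"
  let ?c = "\<lambda>b. if b then 1 else emeasure (K x) (space mu - A)"
  let ?F = "\<lambda>B. emeasure (K x) B + indicator B x * emeasure (K x) (space mu - A)"
  have sub: "subprob_space (restrict_space (K x) A)"
    using x by (intro subprob_spaceI) (auto simp: spK emeasure_restrict_space[OF AK] prob_le_1 emeasure_eq_measure)
  have "(\<integral>\<^sup>+y. f y \<partial>measure_of (space (restrict_space mu A)) (sets (restrict_space mu A)) ?F)
     = (\<Sum>b\<in>UNIV. ?c b * (\<integral>\<^sup>+y. f y \<partial>?N b))"
  proof (rule nn_integral_measure_of_mixture)
    show "subprob_space (?N b)" for b
      using sub prob_space_imp_subprob_space[OF prob_space_return[OF xr]] by simp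
    show "sets (?N b) = sets (restrict_space mu A)" for b
      using Kx(2) by (auto simp: sets_restrict_space)
    fix B assume B: "B \<in> sets (restrict_space mu A)"
    then have "B \<subseteq> A" using sets.sets_into_space sp by metis
    then show "?F B = (\<Sum>b\<in>UNIV. ?c b * emeasure (?N b) B)"
      using B AK by (simp add: UNIV_bool emeasure_restrict_space mult.commute)
  qed (use f in auto)
  then show ?thesis
    using xr f AK by (simp add: restrict_kernel_def sp UNIV_bool nn_integral_return nn_integral_restrict_space mult.commute)
qed

lemma markov_kernel_restrict:
  assumes K: "markov_kernel mu K" and A: "A \<in> sets mu"
  shows "markov_kernel (restrict_space mu A) (restrict_kernel mu K A)"
proof (rule markov_kernelI)
  have sp: "space (restrict_space mu A) = A" using A sets.sets_into_space by (auto simp: space_restrict_space)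
  show sets: "sets (restrict_kernel mu K A x) = sets (restrict_space mu A)" for x
  proof -
    have "sets (restrict_kernel mu K A x) = sigma_sets A (sets (restrict_space mu A))"
      unfolding restrict_kernel_def by (rule sets_measure_of) (use sp sets.space_closed in metis)
    then show ?thesis using sets.sigma_sets_eq[of "restrict_space mu A"] sp by simp
  qed
  have em: "emeasure (restrict_kernel mu K A x) B = emeasure (K x) B + indicator B x * emeasure (K x) (space mu - A)"
    if x: "x \<in> A" and B: "B \<in> sets (restrict_space mu A)" for x B
  proof -
    have xm: "x \<in> space mu" using A x sets.sets_into_space by blast
    have BA: "B \<subseteq> A" using sets.sets_into_space[OF B] sp by simp
    have Bm: "B \<in> sets mu" using B A by (auto simp: sets_restrict_space)
    have "emeasure (restrict_kernel mu K A x) B = (\<integral>\<^sup>+y. indicator B y \<partial>restrict_kernel mu K A x)"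
      using B sets by simp
    also have "\<dots> = (\<integral>\<^sup>+y. indicator B y * indicator A y \<partial>K x) + indicator B x * emeasure (K x) (space mu - A)"
      by (rule nn_integral_restrict_kernel[OF K A x]) (use B in auto)
    also have "(\<integral>\<^sup>+y. indicator B y * indicator A y \<partial>K x) = (\<integral>\<^sup>+y. indicator B y \<partial>K x)"
      using BA by (intro nn_integral_cong) (auto split: split_indicator)
    also have "\<dots> = emeasure (K x) B" using Bm markov_kernelD(3)[OF K xm] by simp
    finally show ?thesis .
  qed
  show "emeasure (restrict_kernel mu K A x) (space (restrict_space mu A)) = 1"
    if "x \<in> space (restrict_space mu A)" for x
  proof -
    have x: "x \<in> A" using that sp by simp
    have xm: "x \<in> space mu" using A x sets.sets_into_space by blast
    interpret prob_space "K x" by (rule markov_kernelD(2)[OF K xm])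
    have "emeasure (K x) A + emeasure (K x) (space mu - A) = emeasure (K x) (A \<union> (space mu - A))"
      using A markov_kernelD(3)[OF K xm] by (intro plus_emeasure) auto
    also have "A \<union> (space mu - A) = space (K x)"
      using A sets.sets_into_space markov_kernelD(4)[OF K xm] by blast
    finally show ?thesis
      using x by (subst em) (auto simp: sp emeasure_space_1 intro: sets.top[of "restrict_space mu A", unfolded sp])
  qed
  note Km[measurable] = markov_kernelD(1)[OF K]
  fix B assume B: "B \<in> sets (restrict_space mu A)"
  have [measurable]: "B \<in> sets mu" "A \<in> sets mu" using B A by (auto simp: sets_restrict_space)
  have "(\<lambda>x. emeasure (K x) B + indicator B x * emeasure (K x) (space mu - A)) \<in> borel_measurable mu"
    by measurable
  then have "(\<lambda>x. emeasure (K x) B + indicator B x * emeasure (K x) (space mu - A)) \<in> borel_measurable (restrict_space mu A)"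
    by (rule measurable_restrict_space1)
  then show "(\<lambda>x. emeasure (restrict_kernel mu K A x) B) \<in> borel_measurable (restrict_space mu A)"
    by (rule measurable_cong[THEN iffD2, rotated]) (simp add: sp em B)
qed

section \<open>Stationarity and Poincare inequality on a block\<close>

lemma borel_measurable_ext_restrict_space:
  fixes f :: "'b \<Rightarrow> ennreal"
  assumes A: "A \<in> sets mu" and f: "f \<in> borel_measurable (restrict_space mu A)"
  shows "(\<lambda>y. f y * indicator A y) \<in> borel_measurable mu"
  using f A by (subst (asm) borel_measurable_restrict_space_iff_ennreal) auto

text \<open>By reversibility, the mass that rejection holds back at points of A equals the mass that
  the original chain carries into A from outside. Integrated against q, the restricted chain
  therefore treats f as the original chain treats f extended by 0, and stationarity of the latter
  applies.\<close>

lemma nn_stationary_restrict: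
  assumes K: "markov_kernel mu K" and q: "prob_density mu q" and rev: "reversible mu q K"
    and A: "A \<in> sets mu" and c: "0 \<le> c"
  shows "nn_stationary (restrict_space mu A) (\<lambda>x. q x / c) (restrict_kernel mu K A)"
  unfolding nn_stationary_def
proof
  have sp: "space (restrict_space mu A) = A" using A sets.sets_into_space by (auto simp: space_restrict_space)
  have A': "A \<inter> space mu \<in> sets mu" using A by simp
  note Km[measurable] = markov_kernelD(1)[OF K]
  note qm[measurable] = prob_densityD(1)[OF q]
  note [measurable] = A
  fix f :: "_ \<Rightarrow> ennreal" assume f: "f \<in> borel_measurable (restrict_space mu A)"
  let ?f = "\<lambda>y. f y * indicator A y"
  have fm[measurable]: "?f \<in> borel_measurable mu" using A f by (rule borel_measurable_ext_restrict_space)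
  have [measurable]: "(\<lambda>x. \<integral>\<^sup>+y. ?f y \<partial>K x) \<in> borel_measurable mu"
    by (intro measurable_compose[OF Km] nn_integral_measurable_subprob_algebra fm)
  have qc: "ennreal (q x / c) = ennreal (1 / c) * ennreal (q x)" if "x \<in> space mu" for x
    using c prob_densityD(2)[OF q that] by (simp flip: ennreal_mult')
  have "(\<integral>\<^sup>+x. ennreal (q x / c) * (\<integral>\<^sup>+y. f y \<partial>restrict_kernel mu K A x) \<partial>restrict_space mu A)
     = (\<integral>\<^sup>+x. ennreal (q x / c) * (\<integral>\<^sup>+y. f y \<partial>restrict_kernel mu K A x) * indicator A x \<partial>mu)"
    by (rule nn_integral_restrict_space[OF A'])
  also have "\<dots> = (\<integral>\<^sup>+x. ennreal (1 / c) * (indicator A x * ennreal (q x) * (\<integral>\<^sup>+y. ?f y \<partial>K x)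
        + ennreal (q x) * emeasure (K x) (space mu - A) * ?f x) \<partial>mu)"
    by (intro nn_integral_cong)
      (auto simp: nn_integral_restrict_kernel[OF K A _ f] qc algebra_simps split: split_indicator)
  also have "\<dots> = ennreal (1 / c) * ((\<integral>\<^sup>+x. indicator A x * ennreal (q x) * (\<integral>\<^sup>+y. ?f y \<partial>K x) \<partial>mu)
        + (\<integral>\<^sup>+x. ennreal (q x) * emeasure (K x) (space mu - A) * ?f x \<partial>mu))"
    by (simp add: nn_integral_cmult nn_integral_add)
  also have "(\<integral>\<^sup>+x. ennreal (q x) * emeasure (K x) (space mu - A) * ?f x \<partial>mu)
     = (\<integral>\<^sup>+x. indicator (space mu - A) x * ennreal (q x) * (\<integral>\<^sup>+y. ?f y \<partial>K x) \<partial>mu)"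
    by (rule reversible_nn_integral[OF K q rev _ fm, symmetric]) simp
  also have "(\<integral>\<^sup>+x. indicator A x * ennreal (q x) * (\<integral>\<^sup>+y. ?f y \<partial>K x) \<partial>mu) + \<dots>
     = (\<integral>\<^sup>+x. indicator A x * ennreal (q x) * (\<integral>\<^sup>+y. ?f y \<partial>K x) + indicator (space mu - A) x * ennreal (q x) * (\<integral>\<^sup>+y. ?f y \<partial>K x) \<partial>mu)"
    by (simp add: nn_integral_add)
  also have "\<dots> = (\<integral>\<^sup>+x. ennreal (q x) * (\<integral>\<^sup>+y. ?f y \<partial>K x) \<partial>mu)"
    by (intro nn_integral_cong) (auto split: split_indicator)
  also have "\<dots> = (\<integral>\<^sup>+x. ennreal (q x) * ?f x \<partial>mu)"
    using reversible_imp_nn_stationary[OF K q rev] fm unfolding nn_stationary_def by blast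
  also have "ennreal (1 / c) * \<dots> = (\<integral>\<^sup>+x. ennreal (1 / c) * (ennreal (q x) * ?f x) \<partial>mu)"
    by (simp add: nn_integral_cmult)
  also have "\<dots> = (\<integral>\<^sup>+x. ennreal (q x / c) * f x * indicator A x \<partial>mu)"
    by (intro nn_integral_cong) (auto simp: qc ac_simps)
  also have "\<dots> = (\<integral>\<^sup>+x. ennreal (q x / c) * f x \<partial>restrict_space mu A)"
    by (rule nn_integral_restrict_space[OF A', symmetric])
  finally show "(\<integral>\<^sup>+x. ennreal (q x / c) * (\<integral>\<^sup>+y. f y \<partial>restrict_kernel mu K A x) \<partial>restrict_space mu A)
    = (\<integral>\<^sup>+x. ennreal (q x / c) * f x \<partial>restrict_space mu A)" .
qed

lemma prob_density_restrict:
  assumes q: "prob_density mu q" and A: "A \<in> sets mu" and c: "mass mu q A > 0"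
  shows "prob_density (restrict_space mu A) (\<lambda>x. q x / mass mu q A)"
proof -
  have A': "A \<inter> space mu \<in> sets mu" using A by simp
  note [measurable] = prob_densityD(1)[OF q] A
  have i: "integrable mu (\<lambda>x. indicator A x * q x)"
    using integrable_mult_indicator[OF A prob_densityD(3)[OF q]] by simp
  have q2: "integrable mu (\<lambda>x. indicator A x *\<^sub>R (q x / mass mu q A))"
    using integrable_divide[OF i, of "mass mu q A"] by simp
  show ?thesis unfolding prob_density_def
  proof (intro conjI ballI)
    show "(\<lambda>x. q x / mass mu q A) \<in> borel_measurable (restrict_space mu A)"
      by (rule measurable_restrict_space1) measurable
    show "0 \<le> q x / mass mu q A" if "x \<in> space (restrict_space mu A)" for x
      using that c prob_densityD(2)[OF q, of x] sets.sets_into_space[OF A]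
      by (auto simp: space_restrict_space)
    show "integrable (restrict_space mu A) (\<lambda>x. q x / mass mu q A)"
      using q2 by (simp add: integrable_restrict_space[OF A'])
    have "(\<integral>x. q x / mass mu q A \<partial>restrict_space mu A) = (\<integral>x. indicator A x * q x / mass mu q A \<partial>mu)"
      by (simp add: integral_restrict_space[OF A'])
    also have "\<dots> = (\<integral>x. indicator A x * q x \<partial>mu) / mass mu q A"
      by (rule integral_divide_zero)
    finally show "(\<integral>x. q x / mass mu q A \<partial>restrict_space mu A) = 1"
      using c by (simp add: mass_def)
  qed
qed

lemma L2_restrict:
  assumes A: "A \<in> sets mu" and g: "L2 mu q g"
  shows "L2 (restrict_space mu A) (\<lambda>x. q x / c) g"
proof -
  have A': "A \<inter> space mu \<in> sets mu" using A by simp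
  have gm: "g \<in> borel_measurable mu" and g2: "integrable mu (\<lambda>x. (g x)\<^sup>2 * q x)"
    using g by (auto simp: L2_def)
  have "integrable mu (\<lambda>x. indicator A x *\<^sub>R ((g x)\<^sup>2 * q x / c))"
    using integrable_divide[OF integrable_mult_indicator[OF A g2], of c] by simp
  then show ?thesis using measurable_restrict_space1[OF gm]
    by (simp add: L2_def integrable_restrict_space[OF A'])
qed

text \<open>The normalisation by \<open>mass mu q A\<close> occurs on both sides and is cancelled,
  so that the inequalities of all blocks of one level can be added. The witness m is the mean of g
  under q conditioned on A.\<close>

lemma restricted_gap_poincare:
  assumes K: "markov_kernel mu K" and q: "prob_density mu q" and rev: "reversible mu q K"
    and A: "A \<in> sets mu" and c: "mass mu q A > 0" and g: "L2 mu q g"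
    and \<gamma>: "0 \<le> \<gamma>" "\<gamma> \<le> restricted_gap mu q K A"
  shows "\<exists>m. ennreal (2 * \<gamma>) * (\<integral>\<^sup>+x. indicator A x * ennreal (q x * (g x - m)\<^sup>2) \<partial>mu)
     \<le> (\<integral>\<^sup>+x. indicator A x * (ennreal (q x) * (\<integral>\<^sup>+y. indicator A y * ennreal ((g x - g y)\<^sup>2) \<partial>K x)) \<partial>mu)"
proof -
  define c where "c = mass mu q A"
  have c0: "0 < c" using assms by (simp add: c_def)
  let ?R = "restrict_space mu A" and ?q = "\<lambda>x. q x / c" and ?K = "restrict_kernel mu K A"
  have A': "A \<inter> space mu \<in> sets mu" using A by simp
  note Km[measurable] = markov_kernelD(1)[OF K]
  have [measurable]: "g \<in> borel_measurable mu" "q \<in> borel_measurable mu" "A \<in> sets mu"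
    using g prob_densityD(1)[OF q] A by (auto simp: L2_def)
  have qR: "prob_density ?R ?q" unfolding c_def by (rule prob_density_restrict[OF q A assms(5)])
  have KR: "markov_kernel ?R ?K" by (rule markov_kernel_restrict[OF K A])
  have sR: "nn_stationary ?R ?q ?K" by (rule nn_stationary_restrict[OF K q rev A]) (use c0 in simp)
  have gR: "L2 ?R ?q g" by (rule L2_restrict[OF A g])
  define m where "m = (\<integral>y. g y * ?q y \<partial>?R)"
  have qc: "ennreal (q x / c) = ennreal (1 / c) * ennreal (q x)" if "x \<in> space mu" for x
    using c0 prob_densityD(2)[OF q that] by (simp flip: ennreal_mult')
  have qc2: "ennreal (q x * z / c) = ennreal (1 / c) * ennreal (q x * z)" if "0 \<le> z" "x \<in> space mu" for x z
    using c0 prob_densityD(2)[OF q that(2)] that(1) by (simp flip: ennreal_mult')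
  have Im[measurable]: "(\<lambda>x. \<integral>\<^sup>+y. indicator A y * ennreal ((g x - g y)\<^sup>2) \<partial>K x) \<in> borel_measurable mu"
    by (rule nn_integral_measurable_subprob_algebra2[OF _ Km]) measurable
  let ?X = "\<integral>\<^sup>+x. indicator A x * ennreal (q x * (g x - m)\<^sup>2) \<partial>mu"
  let ?Y = "\<integral>\<^sup>+x. indicator A x * (ennreal (q x) * (\<integral>\<^sup>+y. indicator A y * ennreal ((g x - g y)\<^sup>2) \<partial>K x)) \<partial>mu"
  have var: "ennreal (var_pi ?R ?q g) = ennreal (1 / c) * ?X"
    unfolding var_pi_eq(1)[OF qR gR] m_def[symmetric]
    by (subst nn_integral_restrict_space[OF A'], subst nn_integral_cmult[symmetric])
      (auto intro!: nn_integral_cong simp: qc2 split: split_indicator)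
  have gRm: "(\<lambda>y. ennreal ((g x - g y)\<^sup>2)) \<in> borel_measurable ?R" for x
    by (rule measurable_restrict_space1) measurable
  \<comment> \<open>Rejected moves leave x fixed and contribute (g x - g x)^2 = 0, so only pairs
    inside A remain.\<close>
  have en: "energy ?R ?q ?K g = ennreal (1 / c) * ?Y"
    unfolding energy_def
    by (subst nn_integral_restrict_space[OF A'], subst nn_integral_cmult[symmetric])
      (auto intro!: nn_integral_cong simp: qc nn_integral_restrict_kernel[OF K A _ gRm] mult.assoc mult.commute[of _ "indicator _ _"]
        split: split_indicator)
  have "\<gamma> * var_pi ?R ?q g \<le> dirichlet_form ?R ?q ?K g"
    using \<gamma>(2) unfolding restricted_gap_def c_def[symmetric]
    by (rule poincare_spectral_gap[OF KR qR sR gR])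
  then have "ennreal (2 * \<gamma> * var_pi ?R ?q g) \<le> energy ?R ?q ?K g"
    unfolding energy_eq_dirichlet_form(1)[OF KR qR sR gR] by (intro ennreal_leI) simp
  then have "ennreal (2 * \<gamma>) * ennreal (var_pi ?R ?q g) \<le> energy ?R ?q ?K g"
    using \<gamma>(1) by (simp add: ennreal_mult'[of "2 * \<gamma>"])
  then have "ennreal (1 / c) * (ennreal (2 * \<gamma>) * ?X) \<le> ennreal (1 / c) * ?Y"
    unfolding var en by (simp add: ac_simps)
  then have "ennreal (2 * \<gamma>) * ?X \<le> ?Y"
    by (subst (asm) ennreal_mult_le_mult_iff) (use c0 in auto)
  then show ?thesis by blast
qed

text \<open>This is I - P \<le> 2 I, obtained from (a - b)^2 \<le> 2 a^2 + 2 b^2 around a centre m,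
  where stationarity makes the two halves equal. It is the source of the bound 2 on the restricted
  gap.\<close>

lemma energy_le_variance:
  assumes K: "markov_kernel mu K" and q: "prob_density mu q" and stat: "nn_stationary mu q K"
    and g: "g \<in> borel_measurable mu"
  shows "energy mu q K g \<le> 4 * (\<integral>\<^sup>+x. ennreal (q x * (g x - m)\<^sup>2) \<partial>mu)"
proof -
  note Km[measurable] = markov_kernelD(1)[OF K]
  note [measurable] = g prob_densityD(1)[OF q]
  define f where "f x = ennreal ((g x - m)\<^sup>2)" for x
  have fm[measurable]: "f \<in> borel_measurable mu" unfolding f_def by measurable
  have [measurable]: "(\<lambda>x. \<integral>\<^sup>+y. f y \<partial>K x) \<in> borel_measurable mu"
    by (intro measurable_compose[OF Km] nn_integral_measurable_subprob_algebra fm)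
  have "energy mu q K g \<le> (\<integral>\<^sup>+x. 2 * (ennreal (q x) * f x) + 2 * (ennreal (q x) * (\<integral>\<^sup>+y. f y \<partial>K x)) \<partial>mu)"
    unfolding energy_def
  proof (rule nn_integral_mono)
    fix x assume x: "x \<in> space mu"
    interpret prob_space "K x" using markov_kernelD(2)[OF K x] .
    have fK: "f \<in> borel_measurable (K x)"
      using fm by (simp add: markov_kernelD(3)[OF K x] cong: measurable_cong_sets)
    have "(\<integral>\<^sup>+y. ennreal ((g x - g y)\<^sup>2) \<partial>K x) \<le> (\<integral>\<^sup>+y. 2 * f x + 2 * f y \<partial>K x)"
    proof (rule nn_integral_mono)
      fix y
      have "(g x - g y)\<^sup>2 \<le> 2 * (g x - m)\<^sup>2 + 2 * (g y - m)\<^sup>2"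
        using zero_le_power2[of "(g x - m) + (g y - m)"] by (simp add: power2_eq_square algebra_simps)
      then have "ennreal ((g x - g y)\<^sup>2) \<le> ennreal (2 * (g x - m)\<^sup>2 + 2 * (g y - m)\<^sup>2)"
        by (rule ennreal_leI)
      then show "ennreal ((g x - g y)\<^sup>2) \<le> 2 * f x + 2 * f y"
        by (simp add: f_def ennreal_mult)
    qed
    also have "\<dots> = 2 * f x + 2 * (\<integral>\<^sup>+y. f y \<partial>K x)"
      using fK by (simp add: nn_integral_add nn_integral_cmult emeasure_space_1)
    finally have "ennreal (q x) * (\<integral>\<^sup>+y. ennreal ((g x - g y)\<^sup>2) \<partial>K x) \<le> ennreal (q x) * (2 * f x + 2 * (\<integral>\<^sup>+y. f y \<partial>K x))"
      by (rule mult_left_mono) simp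
    then show "ennreal (q x) * (\<integral>\<^sup>+y. ennreal ((g x - g y)\<^sup>2) \<partial>K x)
        \<le> 2 * (ennreal (q x) * f x) + 2 * (ennreal (q x) * (\<integral>\<^sup>+y. f y \<partial>K x))"
      by (simp add: ring_distribs ac_simps)
  qed
  also have "\<dots> = 2 * (\<integral>\<^sup>+x. ennreal (q x) * f x \<partial>mu) + 2 * (\<integral>\<^sup>+x. ennreal (q x) * (\<integral>\<^sup>+y. f y \<partial>K x) \<partial>mu)"
    by (simp add: nn_integral_add nn_integral_cmult)
  also have "(\<integral>\<^sup>+x. ennreal (q x) * (\<integral>\<^sup>+y. f y \<partial>K x) \<partial>mu) = (\<integral>\<^sup>+x. ennreal (q x) * f x \<partial>mu)"
    using stat fm unfolding nn_stationary_def by blast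
  also have "(\<integral>\<^sup>+x. ennreal (q x) * f x \<partial>mu) = (\<integral>\<^sup>+x. ennreal (q x * (g x - m)\<^sup>2) \<partial>mu)"
    by (intro nn_integral_cong) (simp add: f_def ennreal_mult prob_densityD(2)[OF q])
  finally show ?thesis by (simp flip: distrib_right)
qed

text \<open>Block energies count only pairs in a common block. The indicator in y is simply dropped,
  because \<open>K x\<close> may charge the null sets on which blocks overlap; the indicators in x
  alone prevent double counting, as almost every x lies in at most one block.\<close>

lemma sum_block_energy_le:
  assumes K: "markov_kernel mu K" and [measurable]: "q \<in> borel_measurable mu" "g \<in> borel_measurable mu"
    and PP: "finite PP" "\<And>A. A \<in> PP \<Longrightarrow> A \<in> sets mu"
    and ov: "AE x in mu. (\<Sum>A\<in>PP. indicator A x) \<le> (1::ennreal)"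
  shows "(\<Sum>A\<in>PP. \<integral>\<^sup>+x. indicator A x * (ennreal (q x) * (\<integral>\<^sup>+y. indicator A y * ennreal ((g x - g y)\<^sup>2) \<partial>K x)) \<partial>mu)
     \<le> energy mu q K g"
proof -
  note Km[measurable] = markov_kernelD(1)[OF K]
  have Im: "(\<lambda>x. \<integral>\<^sup>+y. indicator A y * ennreal ((g x - g y)\<^sup>2) \<partial>K x) \<in> borel_measurable mu"
    if [measurable]: "A \<in> sets mu" for A
    by (rule nn_integral_measurable_subprob_algebra2[OF _ Km]) measurable
  have "(\<Sum>A\<in>PP. \<integral>\<^sup>+x. indicator A x * (ennreal (q x) * (\<integral>\<^sup>+y. indicator A y * ennreal ((g x - g y)\<^sup>2) \<partial>K x)) \<partial>mu)
    = (\<integral>\<^sup>+x. (\<Sum>A\<in>PP. indicator A x * (ennreal (q x) * (\<integral>\<^sup>+y. indicator A y * ennreal ((g x - g y)\<^sup>2) \<partial>K x))) \<partial>mu)"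
    using PP(2) Im
    by (intro nn_integral_sum[symmetric]) (auto intro!: borel_measurable_times_ennreal)
  also have "\<dots> \<le> energy mu q K g"
    unfolding energy_def
  proof (rule nn_integral_mono_AE)
    show "AE x in mu. (\<Sum>A\<in>PP. indicator A x * (ennreal (q x) * (\<integral>\<^sup>+y. indicator A y * ennreal ((g x - g y)\<^sup>2) \<partial>K x)))
      \<le> ennreal (q x) * (\<integral>\<^sup>+y. ennreal ((g x - g y)\<^sup>2) \<partial>K x)"
      using ov
    proof eventually_elim
      case (elim x)
      have "(\<integral>\<^sup>+y. indicator A y * ennreal ((g x - g y)\<^sup>2) \<partial>K x) \<le> (\<integral>\<^sup>+y. ennreal ((g x - g y)\<^sup>2) \<partial>K x)" for A
        by (intro nn_integral_mono) (auto split: split_indicator)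
      then have "(\<Sum>A\<in>PP. indicator A x * (ennreal (q x) * (\<integral>\<^sup>+y. indicator A y * ennreal ((g x - g y)\<^sup>2) \<partial>K x)))
        \<le> (\<Sum>A\<in>PP. indicator A x * (ennreal (q x) * (\<integral>\<^sup>+y. ennreal ((g x - g y)\<^sup>2) \<partial>K x)))"
        by (intro sum_mono mult_left_mono) auto
      also have "\<dots> = (\<Sum>A\<in>PP. indicator A x) * (ennreal (q x) * (\<integral>\<^sup>+y. ennreal ((g x - g y)\<^sup>2) \<partial>K x))"
        by (simp add: sum_distrib_right)
      also have "\<dots> \<le> 1 * (ennreal (q x) * (\<integral>\<^sup>+y. ennreal ((g x - g y)\<^sup>2) \<partial>K x))"
        by (rule mult_right_mono[OF elim]) simp
      finally show ?case by simp
    qed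
  qed
  finally show ?thesis .
qed

text \<open>The test function is bounded, hence square integrable for every density, and injective
  in b \<bullet> x, so its level sets lie in hyperplanes, which are Lebesgue null. It therefore
  differs from c almost everywhere.\<close>

lemma variance_arctan_inner_pos:
  fixes \<Omega> :: "'a::euclidean_space set"
  assumes \<Omega>: "\<Omega> \<in> sets lborel" and q: "prob_density (state_space \<Omega>) q" and b: "b \<noteq> 0"
  shows "0 < (\<integral>\<^sup>+x. ennreal (q x * (arctan (b \<bullet> x) - c)\<^sup>2) \<partial>state_space \<Omega>)"
proof (rule ccontr)
  assume "\<not> ?thesis"
  then have 0: "(\<integral>\<^sup>+x. ennreal (q x * (arctan (b \<bullet> x) - c)\<^sup>2) \<partial>state_space \<Omega>) = 0" by simp
  note [measurable] = prob_densityD(1)[OF q]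
  have am[measurable]: "(\<lambda>x. arctan (b \<bullet> x)) \<in> borel_measurable (state_space \<Omega>)"
    unfolding state_space_def by (rule measurable_restrict_space1) measurable
  have "AE x in state_space \<Omega>. ennreal (q x * (arctan (b \<bullet> x) - c)\<^sup>2) = 0"
    using 0 by (subst (asm) nn_integral_0_iff_AE) measurable
  moreover have "AE x in state_space \<Omega>. b \<bullet> x \<noteq> tan c"
  proof -
    have "negligible {x. b \<bullet> x = tan c}" using b by (intro negligible_hyperplane) simp
    moreover have "{x. b \<bullet> x = tan c} \<in> sets lborel"
      using closed_hyperplane[of b "tan c"] by simp
    ultimately have "{x. b \<bullet> x = tan c} \<in> null_sets lborel"
      by (simp add: negligible_iff_null_sets null_sets_completion_iff)
    then have "AE x in lborel. b \<bullet> x \<noteq> tan c" by (rule AE_I') auto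
    then show ?thesis unfolding state_space_def using \<Omega>
      by (subst AE_restrict_space_iff) (auto elim: eventually_mono)
  qed
  ultimately have "AE x in state_space \<Omega>. ennreal (q x) = 0"
    using AE_space
  proof eventually_elim
    case (elim x)
    then have "arctan (b \<bullet> x) \<noteq> c" using tan_arctan by metis
    then have "(arctan (b \<bullet> x) - c)\<^sup>2 > 0" by simp
    moreover have "q x * (arctan (b \<bullet> x) - c)\<^sup>2 \<le> 0" using elim by (simp add: ennreal_eq_0_iff)
    ultimately have "q x \<le> 0" by (simp add: mult_le_0_iff)
    then show ?case by (simp add: ennreal_eq_0_iff)
  qed
  then have "(\<integral>\<^sup>+x. ennreal (q x) \<partial>state_space \<Omega>) = 0"
    by (subst nn_integral_0_iff_AE) measurable
  then show False using prob_densityD(5)[OF q] by simp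
qed

section \<open>The simulated tempering chain\<close>

locale tempering =
  fixes \<Omega> :: "'a::euclidean_space set" and L :: nat
    and P :: "nat \<Rightarrow> 'a \<Rightarrow> 'a measure" and p :: "nat \<Rightarrow> 'a \<Rightarrow> real" and r :: "nat \<Rightarrow> real"
  assumes \<Omega>: "\<Omega> \<in> sets lborel" and L: "L \<ge> 1"
    and kernel: "\<And>i. i \<in> {1..L} \<Longrightarrow> markov_kernel (state_space \<Omega>) (P i)"
    and dens: "\<And>i. i \<in> {1..L} \<Longrightarrow> prob_density (state_space \<Omega>) (p i)"
    and rev: "\<And>i. i \<in> {1..L} \<Longrightarrow> reversible (state_space \<Omega>) (p i) (P i)"
    and r_pos: "\<And>i. i \<in> {1..L} \<Longrightarrow> r i > 0" and r_sum: "(\<Sum>i\<in>{1..L}. r i) = 1"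
begin

abbreviation mu where "mu \<equiv> state_space \<Omega>"
abbreviation st where "st \<equiv> st_space \<Omega> L"
abbreviation K where "K \<equiv> st_kernel \<Omega> L P p r"

text \<open>Equilibrium rate of accepted changes from level k to level k' at x, up to the factor 1 /
  (2 L). Its symmetry in k and k' is the detailed balance of these moves.\<close>

definition flow :: "nat \<Rightarrow> nat \<Rightarrow> 'a \<Rightarrow> real" where
  "flow k k' x = min (r k * p k x) (r k' * p k' x)"

lemma space_mu[simp]: "space mu = \<Omega>"
  using sets.sets_into_space[OF \<Omega>] by (simp add: state_space_def space_restrict_space)

lemma space_st[simp]: "space st = \<Omega> \<times> {1..L}"
  by (simp add: st_space_def space_pair_measure)

lemma p_measurable[measurable]: "i \<in> {1..L} \<Longrightarrow> p i \<in> borel_measurable mu"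
  by (rule prob_densityD(1)[OF dens])

lemma p_nonneg: "i \<in> {1..L} \<Longrightarrow> x \<in> \<Omega> \<Longrightarrow> 0 \<le> p i x"
  using prob_densityD(2)[OF dens] by simp

lemma measurable_st_section:
  assumes "f \<in> st \<rightarrow>\<^sub>M N" "k \<in> {1..L}"
  shows "(\<lambda>x. f (x, k)) \<in> mu \<rightarrow>\<^sub>M N"
  using assms by (intro measurable_compose[OF measurable_Pair2' assms(1)[unfolded st_space_def]]) simp

lemma measurable_st:
  assumes [measurable]: "\<And>k. k \<in> {1..L} \<Longrightarrow> (\<lambda>x. f (x, k)) \<in> mu \<rightarrow>\<^sub>M N"
  shows "f \<in> st \<rightarrow>\<^sub>M N"
proof -
  have "(\<lambda>z. (\<lambda>k z. f (fst z, k)) (snd z) z) \<in> st \<rightarrow>\<^sub>M N"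
    unfolding st_space_def
    by (rule measurable_compose_countable'[where I="{1..L}"]) measurable
  then show ?thesis by simp
qed

lemma nn_integral_st:
  assumes f: "f \<in> borel_measurable st"
  shows "(\<integral>\<^sup>+z. f z \<partial>st) = (\<Sum>k\<in>{1..L}. \<integral>\<^sup>+x. f (x, k) \<partial>mu)"
proof -
  interpret sigma_finite_measure "count_space {1..L}"
    by (rule sigma_finite_measure_count_space_finite) simp
  have "(\<integral>\<^sup>+z. f z \<partial>st) = (\<integral>\<^sup>+x. \<integral>\<^sup>+k. f (x, k) \<partial>count_space {1..L} \<partial>mu)"
    using f unfolding st_space_def by (rule nn_integral_fst[symmetric])
  also have "\<dots> = (\<integral>\<^sup>+x. (\<Sum>k\<in>{1..L}. f (x, k)) \<partial>mu)"
    by (simp add: nn_integral_count_space_finite)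
  also have "\<dots> = (\<Sum>k\<in>{1..L}. \<integral>\<^sup>+x. f (x, k) \<partial>mu)"
    by (rule nn_integral_sum) (rule measurable_st_section[OF f])
  finally show ?thesis .
qed

lemma sum_r_ennreal: "(\<Sum>k\<in>{1..L}. ennreal (r k)) = 1"
  using r_pos r_sum by (subst sum_ennreal) (auto intro: less_imp_le)

lemma density_measurable[measurable]: "st_density p r \<in> borel_measurable st"
  by (rule measurable_st) (auto simp: st_density_def)

lemma prob_density_st: "prob_density st (st_density p r)"
proof -
  have nn: "0 \<le> st_density p r z" if "z \<in> space st" for z
    using that p_nonneg r_pos by (auto simp: st_density_def less_imp_le)
  have "(\<integral>\<^sup>+z. ennreal (st_density p r z) \<partial>st) = (\<Sum>k\<in>{1..L}. \<integral>\<^sup>+x. ennreal (r k) * ennreal (p k x) \<partial>mu)"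
    by (subst nn_integral_st, measurable)
      (auto intro!: sum.cong nn_integral_cong simp: st_density_def ennreal_mult p_nonneg r_pos less_imp_le)
  also have "\<dots> = (\<Sum>k\<in>{1..L}. ennreal (r k))"
    by (intro sum.cong) (auto simp: nn_integral_cmult prob_densityD(5)[OF dens])
  finally have 1: "(\<integral>\<^sup>+z. ennreal (st_density p r z) \<partial>st) = 1" by (simp only: sum_r_ennreal)
  have i: "integrable st (st_density p r)"
    using 1 nn by (intro integrableI_nonneg) (auto simp del: space_st)
  have "(\<integral>z. st_density p r z \<partial>st) = 1"
    using 1 nn by (subst integral_eq_nn_integral) (auto simp del: space_st)
  then show ?thesis using i nn unfolding prob_density_def by auto
qed

lemma L2_section:
  assumes g: "L2 st (st_density p r) g" and k: "k \<in> {1..L}"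
  shows "L2 mu (p k) (\<lambda>x. g (x, k))"
proof -
  have gm[measurable]: "g \<in> borel_measurable st" and gi: "integrable st (\<lambda>z. (g z)\<^sup>2 * st_density p r z)"
    using g by (auto simp: L2_def)
  note gk[measurable] = measurable_st_section[OF gm k] and pk[measurable] = p_measurable[OF k]
  let ?I = "\<lambda>k. \<integral>\<^sup>+x. ennreal ((g (x, k))\<^sup>2 * (r k * p k x)) \<partial>mu"
  have "(\<integral>\<^sup>+z. ennreal ((g z)\<^sup>2 * st_density p r z) \<partial>st) < \<infinity>"
    using integrableD(2)[OF gi] by (simp add: less_top)
  moreover have "(\<integral>\<^sup>+z. ennreal ((g z)\<^sup>2 * st_density p r z) \<partial>st) = (\<Sum>k\<in>{1..L}. ?I k)"
    by (subst nn_integral_st, measurable) (simp add: st_density_def)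
  ultimately have "?I k < \<infinity>" using k by (auto simp: less_top[symmetric])
  moreover have "?I k = (\<integral>\<^sup>+x. ennreal (r k) * ennreal ((g (x, k))\<^sup>2 * p k x) \<partial>mu)"
    using r_pos[OF k] p_nonneg[OF k] by (intro nn_integral_cong) (simp add: ac_simps flip: ennreal_mult)
  moreover have "\<dots> = ennreal (r k) * (\<integral>\<^sup>+x. ennreal ((g (x, k))\<^sup>2 * p k x) \<partial>mu)"
    by (rule nn_integral_cmult) measurable
  ultimately have "(\<integral>\<^sup>+x. ennreal ((g (x, k))\<^sup>2 * p k x) \<partial>mu) < \<infinity>"
    using r_pos[OF k] by (auto simp: ennreal_mult_less_top)
  then have "integrable mu (\<lambda>x. (g (x, k))\<^sup>2 * p k x)"
    using p_nonneg[OF k] by (intro integrableI_nonneg) (auto intro!: AE_I2)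
  then show ?thesis by (simp add: L2_def)
qed

section \<open>Acceptance probabilities and the tempering kernel\<close>

lemma accept_bounds:
  assumes "x \<in> \<Omega>" "k \<in> {1..L}" "k' \<in> {1..L}"
  shows "0 \<le> st_accept p r x k k'" "st_accept p r x k k' \<le> 1"
  using assms r_pos p_nonneg by (auto simp: st_accept_def less_imp_le)

lemma density_accept:
  assumes "x \<in> \<Omega>" "k \<in> {1..L}" "k' \<in> {1..L}"
  shows "r k * p k x * st_accept p r x k k' = flow k k' x"
\<comment> \<open>If \<open>p k x = 0\<close>, the quotient in \<open>st_accept\<close> has
  denominator 0 and hence value 0. Both sides are then 0, so points of vanishing density need no
  separate treatment later.\<close>
proof (cases "p k x = 0")
  case True
  then show ?thesis using assms r_pos p_nonneg by (auto simp: flow_def less_imp_le)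
next
  case False
  then have "0 < r k * p k x" using assms r_pos[of k] p_nonneg[of k x] by simp
  then show ?thesis using False r_pos[OF assms(2)]
    by (simp add: st_accept_def flow_def min_mult_distrib_left min.commute)
qed

lemma nn_integral_st_kernel:
  assumes x: "x \<in> \<Omega>" and k: "k \<in> {1..L}" and f: "f \<in> borel_measurable st"
  shows "(\<integral>\<^sup>+w. f w \<partial>K (x, k)) = 1/2 * (\<integral>\<^sup>+y. f (y, k) \<partial>P k x)
      + (\<Sum>k'\<in>{1..L}. ennreal (1 / (2 * real L)) *
          (ennreal (st_accept p r x k k') * f (x, k') + ennreal (1 - st_accept p r x k k') * f (x, k)))"
proof -
  have xm: "x \<in> space mu" using x by simp
  note Px = markov_kernelD(2-4)[OF kernel[OF k] xm]
  interpret Px: prob_space "P k x" by (rule Px(1))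
  have pm: "(\<lambda>y. (y, k)) \<in> P k x \<rightarrow>\<^sub>M st"
    using k measurable_Pair2'[of k "count_space {1..L}" mu]
    by (simp add: st_space_def Px(2) cong: measurable_cong_sets)
  let ?a = "st_accept p r x k"
  let ?b = "\<lambda>k' b. if b then (x, k') else (x, k)"
  have bm: "?b k' \<in> measure_pmf (bernoulli_pmf (?a k')) \<rightarrow>\<^sub>M st" if "k' \<in> {1..L}" for k'
    using that x k by (auto simp: Pi_iff)
  \<comment> \<open>Levels start at 1, so index 0 is free for the move within level k. Index i
    stands for the proposal of level i, accepted by a Bernoulli variable with parameter
    \<open>?a i\<close>.\<close>
  let ?N = "\<lambda>i. if i = 0 then distr (P k x) st (\<lambda>y. (y, k))
     else distr (measure_pmf (bernoulli_pmf (?a i))) st (?b i)"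
  let ?c = "\<lambda>i. if i = (0::nat) then 1/2 else ennreal (1 / (2 * real L))"
  let ?F = "\<lambda>B. (1/2) * emeasure (P k x) {y \<in> \<Omega>. (y, k) \<in> B}
        + (\<Sum>k'\<in>{1..L}. ennreal ((1 / (2 * real L)) *
             (?a k' * indicator B (x, k') + (1 - ?a k') * indicator B (x, k))))"
  have N0: "(\<integral>\<^sup>+w. h w \<partial>?N 0) = (\<integral>\<^sup>+y. h (y, k) \<partial>P k x)" if "h \<in> borel_measurable st" for h
    using that by (simp add: nn_integral_distr[OF pm])
  have Ni: "(\<integral>\<^sup>+w. h w \<partial>?N k') = ennreal (?a k') * h (x, k') + ennreal (1 - ?a k') * h (x, k)"
    if k': "k' \<in> {1..L}" and h: "h \<in> borel_measurable st" for h k'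
    using k' h accept_bounds[OF x k k']
    by (simp add: nn_integral_distr[OF bm[OF k']] nn_integral_bernoulli_pmf mult.commute)
  have sum: "(\<Sum>i\<in>{0..L}. G i) = G 0 + (\<Sum>i\<in>{1..L}. G i)" for G :: "nat \<Rightarrow> ennreal"
    by (simp add: sum.atLeast_Suc_atMost)
  have "(\<integral>\<^sup>+w. f w \<partial>K (x, k)) = (\<integral>\<^sup>+w. f w \<partial>measure_of (space st) (sets st) ?F)"
    by (simp add: st_kernel_def del: space_st)
  also have "\<dots> = (\<Sum>i\<in>{0..L}. ?c i * (\<integral>\<^sup>+w. f w \<partial>?N i))"
  proof (rule nn_integral_measure_of_mixture)
    fix i assume i: "i \<in> {0..L}"
    show "sets (?N i) = sets st" by simp
    have "prob_space (?N i)"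
      using Px.prob_space_distr[OF pm] prob_space.prob_space_distr[OF prob_space_measure_pmf bm[of i]] i
      by simp
    then show "subprob_space (?N i)" by (rule prob_space_imp_subprob_space)
  next
    fix B assume B: "B \<in> sets st"
    have "(\<Sum>i\<in>{0..L}. ?c i * emeasure (?N i) B) = (\<Sum>i\<in>{0..L}. ?c i * (\<integral>\<^sup>+w. indicator B w \<partial>?N i))"
      using B by (intro sum.cong) auto
    also have "\<dots> = 1/2 * (\<integral>\<^sup>+w. indicator B w \<partial>?N 0)
       + (\<Sum>i\<in>{1..L}. ennreal (1 / (2 * real L)) * (\<integral>\<^sup>+w. indicator B w \<partial>?N i))"
      unfolding sum by simp
    also have "(\<integral>\<^sup>+w. indicator B w \<partial>?N 0) = emeasure (P k x) {y \<in> \<Omega>. (y, k) \<in> B}"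
    proof -
      have "(\<integral>\<^sup>+w. indicator B w \<partial>?N 0) = emeasure (?N 0) B" using B by simp
      also have "\<dots> = emeasure (P k x) ((\<lambda>y. (y, k)) -` B \<inter> space (P k x))"
        using B by (simp add: emeasure_distr[OF pm])
      also have "(\<lambda>y. (y, k)) -` B \<inter> space (P k x) = {y \<in> \<Omega>. (y, k) \<in> B}" using Px(3) by auto
      finally show ?thesis .
    qed
    also have "(\<Sum>i\<in>{1..L}. ennreal (1 / (2 * real L)) * (\<integral>\<^sup>+w. indicator B w \<partial>?N i))
      = (\<Sum>k'\<in>{1..L}. ennreal ((1 / (2 * real L)) *
             (?a k' * indicator B (x, k') + (1 - ?a k') * indicator B (x, k))))"
    proof (rule sum.cong[OF refl])
      fix k' assume k': "k' \<in> {1..L}"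
      have "(\<integral>\<^sup>+w. indicator B w \<partial>?N k') = ennreal (?a k' * indicator B (x, k') + (1 - ?a k') * indicator B (x, k))"
        using accept_bounds[OF x k k'] B
        by (subst Ni[OF k']) (auto split: split_indicator simp flip: ennreal_plus)
      then show "ennreal (1 / (2 * real L)) * (\<integral>\<^sup>+w. indicator B w \<partial>?N k')
         = ennreal ((1 / (2 * real L)) * (?a k' * indicator B (x, k') + (1 - ?a k') * indicator B (x, k)))"
        using accept_bounds[OF x k k'] by (simp only:) (subst ennreal_mult, auto)
    qed
    finally show "?F B = (\<Sum>i\<in>{0..L}. ?c i * emeasure (?N i) B)" by simp
  qed (use f in auto)
  also have "\<dots> = 1/2 * (\<integral>\<^sup>+w. f w \<partial>?N 0)
       + (\<Sum>i\<in>{1..L}. ennreal (1 / (2 * real L)) * (\<integral>\<^sup>+w. f w \<partial>?N i))"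
    unfolding sum by simp
  also have "(\<Sum>i\<in>{1..L}. ennreal (1 / (2 * real L)) * (\<integral>\<^sup>+w. f w \<partial>?N i)) = 
     (\<Sum>k'\<in>{1..L}. ennreal (1 / (2 * real L)) *
          (ennreal (?a k') * f (x, k') + ennreal (1 - ?a k') * f (x, k)))"
    by (intro sum.cong refl arg_cong2[where f="(*)"] Ni f)
  also have "(\<integral>\<^sup>+w. f w \<partial>?N 0) = (\<integral>\<^sup>+y. f (y, k) \<partial>P k x)" by (rule N0[OF f])
  finally show ?thesis .
qed

lemma half_ennreal: "(1/2 :: ennreal) = ennreal (1/2)"
  using divide_ennreal[of 1 2] by (simp only: ennreal_1 ennreal_numeral zero_le_one zero_less_numeral)

lemma half_plus_half_ennreal: "(1/2 + 1/2 :: ennreal) = 1"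
proof -
  have "ennreal (1/2) + ennreal (1/2) = ennreal (1/2 + 1/2)" by (rule ennreal_plus[symmetric]) simp_all
  also have "\<dots> = 1" by simp
  finally show ?thesis by (simp only: half_ennreal)
qed

lemma inverse_twice_L: "(\<Sum>k'\<in>{1..L}. ennreal (1 / (2 * real L))) = 1/2"
proof -
  have "(\<Sum>k'\<in>{1..L}. ennreal (1 / (2 * real L))) = ennreal (\<Sum>k'\<in>{1..L}. 1 / (2 * real L))"
    by (rule sum_ennreal) simp
  also have "(\<Sum>k'\<in>{1..L}. 1 / (2 * real L)) = 1 / 2" using L by simp
  finally show ?thesis by (simp only: half_ennreal)
qed

lemma markov_kernel_st: "markov_kernel st K"
proof (rule markov_kernelI)
  show sets: "sets (K z) = sets st" for z
    by (auto simp: st_kernel_def split_beta sets.space_closed sets.sigma_sets_eq simp del: space_st)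
  have em: "emeasure (K (x, k)) B = 1/2 * (\<integral>\<^sup>+y. indicator B (y, k) \<partial>P k x)
      + (\<Sum>k'\<in>{1..L}. ennreal (1 / (2 * real L)) *
          (ennreal (st_accept p r x k k') * indicator B (x, k') + ennreal (1 - st_accept p r x k k') * indicator B (x, k)))"
    if "x \<in> \<Omega>" "k \<in> {1..L}" and B: "B \<in> sets st" for x k B
    using nn_integral_st_kernel[OF that(1,2), of "indicator B"] B sets by simp
  show "emeasure (K z) (space st) = 1" if "z \<in> space st" for z
  proof -
    obtain x k where z: "z = (x, k)" and x: "x \<in> \<Omega>" and k: "k \<in> {1..L}" using \<open>z \<in> space st\<close> by auto
    have xm: "x \<in> space mu" using x by simp
    have "(\<integral>\<^sup>+y. indicator (\<Omega> \<times> {1..L}) (y, k) \<partial>P k x) = (\<integral>\<^sup>+y. 1 \<partial>P k x)"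
      using markov_kernelD(4)[OF kernel[OF k] xm] k by (intro nn_integral_cong) (auto simp: indicator_def)
    also have "\<dots> = 1"
      using prob_space.emeasure_space_1[OF markov_kernelD(2)[OF kernel[OF k] xm]] by simp
    finally have 1: "(\<integral>\<^sup>+y. indicator (\<Omega> \<times> {1..L}) (y, k) \<partial>P k x) = 1" .
    have "emeasure (K z) (space st) = 1/2 + (\<Sum>k'\<in>{1..L}. ennreal (1 / (2 * real L)) *
          (ennreal (st_accept p r x k k') * 1 + ennreal (1 - st_accept p r x k k') * 1))"
      unfolding z using 1 x k by (subst em[OF x k sets.top]) (auto intro!: sum.cong)
    also have "\<dots> = 1/2 + (\<Sum>k'\<in>{1..L}. ennreal (1 / (2 * real L)))"
      using accept_bounds[OF x k] by (intro arg_cong2[where f="(+)"] sum.cong) (auto simp flip: ennreal_plus)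
    also have "\<dots> = 1" by (simp only: inverse_twice_L half_plus_half_ennreal)
    finally show ?thesis .
  qed
  fix B assume B[measurable]: "B \<in> sets st"
  show "(\<lambda>z. emeasure (K z) B) \<in> borel_measurable st"
  proof (rule measurable_st)
    fix k assume k: "k \<in> {1..L}"
    note [measurable] = p_measurable[OF k] markov_kernelD(1)[OF kernel[OF k]]
    have ind[measurable]: "(\<lambda>x. indicator B (x, k')) \<in> borel_measurable mu" if "k' \<in> {1..L}" for k'
      by (rule measurable_st_section[OF _ that]) measurable
    have [measurable]: "(\<lambda>x. \<integral>\<^sup>+y. indicator B (y, k) \<partial>P k x) \<in> borel_measurable mu"
      by (intro measurable_compose[OF markov_kernelD(1)[OF kernel[OF k]]] nn_integral_measurable_subprob_algebra ind[OF k])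
    have acc[measurable]: "(\<lambda>x. st_accept p r x k k') \<in> borel_measurable mu" if "k' \<in> {1..L}" for k'
      unfolding st_accept_def using p_measurable[OF that] by measurable
    have "(\<lambda>x. 1/2 * (\<integral>\<^sup>+y. indicator B (y, k) \<partial>P k x)
      + (\<Sum>k'\<in>{1..L}. ennreal (1 / (2 * real L)) *
          (ennreal (st_accept p r x k k') * indicator B (x, k') + ennreal (1 - st_accept p r x k k') * indicator B (x, k))))
      \<in> borel_measurable mu" (is "?f \<in> _")
      using k by measurable
    then show "(\<lambda>x. emeasure (K (x, k)) B) \<in> borel_measurable mu"
      by (rule measurable_cong[THEN iffD2, rotated]) (simp only: space_mu em[OF _ k B])
  qed
qed

text \<open>Multiplication by the density removes the quotient from the acceptance probability; from
  here on only the symmetric \<open>flow\<close> is seen, also where a density vanishes.\<close>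

lemma density_times_kernel:
  assumes x: "x \<in> \<Omega>" and k: "k \<in> {1..L}" and f: "f \<in> borel_measurable st"
  shows "ennreal (st_density p r (x, k)) * (\<integral>\<^sup>+w. f w \<partial>K (x, k))
     = 1/2 * (ennreal (r k) * (ennreal (p k x) * (\<integral>\<^sup>+y. f (y, k) \<partial>P k x)))
      + (\<Sum>k'\<in>{1..L}. ennreal (1 / (2 * real L)) *
          (ennreal (flow k k' x) * f (x, k') + ennreal (r k * p k x - flow k k' x) * f (x, k)))"
proof -
  have rp: "0 \<le> r k * p k x" using r_pos[OF k] p_nonneg[OF k x] by simp
  have 1: "ennreal (r k * p k x) * (ennreal (st_accept p r x k k') * a + ennreal (1 - st_accept p r x k k') * b)
     = ennreal (flow k k' x) * a + ennreal (r k * p k x - flow k k' x) * b" if k': "k' \<in> {1..L}" for k' a b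
  proof -
    have "ennreal (r k * p k x) * ennreal (st_accept p r x k k') = ennreal (flow k k' x)"
      using accept_bounds[OF x k k'] rp by (simp add: density_accept[OF x k k'] flip: ennreal_mult)
    moreover have "ennreal (r k * p k x) * ennreal (1 - st_accept p r x k k') = ennreal (r k * p k x - flow k k' x)"
      using accept_bounds[OF x k k'] rp
      by (simp add: density_accept[OF x k k', symmetric] right_diff_distrib flip: ennreal_mult)
    ultimately show ?thesis by (simp add: distrib_left flip: mult.assoc)
  qed
  have dist: "c * (h + (\<Sum>k'\<in>{1..L}. F k')) = c * h + (\<Sum>k'\<in>{1..L}. c * F k')" for c h :: ennreal and F
    by (simp add: distrib_left sum_distrib_left)
  have "ennreal (st_density p r (x, k)) * (\<integral>\<^sup>+w. f w \<partial>K (x, k))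
     = 1/2 * (ennreal (r k * p k x) * (\<integral>\<^sup>+y. f (y, k) \<partial>P k x))
      + (\<Sum>k'\<in>{1..L}. ennreal (1 / (2 * real L)) * (ennreal (r k * p k x) *
          (ennreal (st_accept p r x k k') * f (x, k') + ennreal (1 - st_accept p r x k k') * f (x, k))))"
    unfolding nn_integral_st_kernel[OF assms]
    by (simp only: st_density_def prod.case dist mult.left_commute[of "ennreal (r k * p k x)"])
  also have "ennreal (r k * p k x) * (\<integral>\<^sup>+y. f (y, k) \<partial>P k x) = ennreal (r k) * (ennreal (p k x) * (\<integral>\<^sup>+y. f (y, k) \<partial>P k x))"
    using r_pos[OF k] p_nonneg[OF k x] by (simp add: ennreal_mult mult.assoc)
  finally show ?thesis by (simp only: 1 cong: sum.cong)
qed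

section \<open>Stationarity and energy of the tempering chain\<close>

lemma flow_measurable[measurable]:
  assumes "k \<in> {1..L}" "k' \<in> {1..L}"
  shows "flow k k' \<in> borel_measurable mu"
  unfolding flow_def using p_measurable[OF assms(1)] p_measurable[OF assms(2)] by measurable

lemma flow_bounds:
  assumes "x \<in> \<Omega>" "k \<in> {1..L}" "k' \<in> {1..L}"
  shows "0 \<le> flow k k' x" "flow k k' x \<le> r k * p k x"
  using assms r_pos p_nonneg by (auto simp: flow_def less_imp_le)

text \<open>\<open>U k k'\<close> collects the accepted moves from k to k', \<open>W k k'\<close>
  the rejected ones, and \<open>T k\<close> is the target on level k. Symmetry of
  \<open>flow\<close> makes the inflow \<open>U k' k\<close> complement \<open>W k k'\<close> to
  \<open>T k\<close>, and exchanging the sums over k and k' turns outflow into inflow. Moves within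
  a level are covered by stationarity of \<open>P k\<close>.\<close>

lemma nn_stationary_st: "nn_stationary st (st_density p r) K"
  unfolding nn_stationary_def
proof
  fix f :: "_ \<Rightarrow> ennreal" assume f[measurable]: "f \<in> borel_measurable st"
  have fk[measurable]: "(\<lambda>x. f (x, k)) \<in> borel_measurable mu" if "k \<in> {1..L}" for k
    by (rule measurable_st_section[OF f that])
  have Pf[measurable]: "(\<lambda>x. \<integral>\<^sup>+y. f (y, k) \<partial>P k x) \<in> borel_measurable mu" if "k \<in> {1..L}" for k
    by (intro measurable_compose[OF markov_kernelD(1)[OF kernel[OF that]]] nn_integral_measurable_subprob_algebra fk[OF that])
  have Kf[measurable]: "(\<lambda>z. \<integral>\<^sup>+w. f w \<partial>K z) \<in> borel_measurable st"
    by (intro measurable_compose[OF markov_kernelD(1)[OF markov_kernel_st]] nn_integral_measurable_subprob_algebra f)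
  define c where "c = ennreal (1 / (2 * real L))"
  define U where "U k k' = (\<integral>\<^sup>+x. ennreal (flow k k' x) * f (x, k') \<partial>mu)" for k k'
  define W where "W k k' = (\<integral>\<^sup>+x. ennreal (r k * p k x - flow k k' x) * f (x, k) \<partial>mu)" for k k'
  define T where "T k = (\<integral>\<^sup>+x. ennreal (r k * p k x) * f (x, k) \<partial>mu)" for k
  have UW: "U k' k + W k k' = T k" if k: "k \<in> {1..L}" and k': "k' \<in> {1..L}" for k k'
  proof -
    note [measurable] = fk[OF k] p_measurable[OF k] flow_measurable[OF k k'] flow_measurable[OF k' k]
    have "U k' k + W k k' = (\<integral>\<^sup>+x. ennreal (flow k' k x) * f (x, k) + ennreal (r k * p k x - flow k k' x) * f (x, k) \<partial>mu)"
      unfolding U_def W_def by (rule nn_integral_add[symmetric]) measurable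
    also have "\<dots> = T k" unfolding T_def
    proof (rule nn_integral_cong)
      fix x assume "x \<in> space mu"
      then have x: "x \<in> \<Omega>" by simp
      have "ennreal (flow k' k x) + ennreal (r k * p k x - flow k k' x) = ennreal (r k * p k x)"
        using flow_bounds[OF x k k'] by (simp add: flow_def min.commute flip: ennreal_plus)
      then show "ennreal (flow k' k x) * f (x, k) + ennreal (r k * p k x - flow k k' x) * f (x, k) = ennreal (r k * p k x) * f (x, k)"
        by (simp flip: distrib_right)
    qed
    finally show ?thesis .
  qed
  have Pk: "(\<integral>\<^sup>+x. ennreal (r k) * (ennreal (p k x) * (\<integral>\<^sup>+y. f (y, k) \<partial>P k x)) \<partial>mu) = T k" if k: "k \<in> {1..L}" for k
  proof -
    note [measurable] = fk[OF k] p_measurable[OF k] Pf[OF k]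
    have "(\<integral>\<^sup>+x. ennreal (r k) * (ennreal (p k x) * (\<integral>\<^sup>+y. f (y, k) \<partial>P k x)) \<partial>mu)
      = ennreal (r k) * (\<integral>\<^sup>+x. ennreal (p k x) * (\<integral>\<^sup>+y. f (y, k) \<partial>P k x) \<partial>mu)"
      by (rule nn_integral_cmult) measurable
    also have "(\<integral>\<^sup>+x. ennreal (p k x) * (\<integral>\<^sup>+y. f (y, k) \<partial>P k x) \<partial>mu) = (\<integral>\<^sup>+x. ennreal (p k x) * f (x, k) \<partial>mu)"
      using reversible_imp_nn_stationary[OF kernel[OF k] dens[OF k] rev[OF k]] fk[OF k]
      unfolding nn_stationary_def by blast
    also have "ennreal (r k) * \<dots> = (\<integral>\<^sup>+x. ennreal (r k) * (ennreal (p k x) * f (x, k)) \<partial>mu)"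
      by (rule nn_integral_cmult[symmetric]) measurable
    also have "\<dots> = T k" unfolding T_def
      using r_pos[OF k] p_nonneg[OF k] by (intro nn_integral_cong) (simp add: ennreal_mult mult.assoc)
    finally show ?thesis .
  qed
  have step: "(\<integral>\<^sup>+x. ennreal (st_density p r (x, k)) * (\<integral>\<^sup>+w. f w \<partial>K (x, k)) \<partial>mu)
     = 1/2 * T k + (\<Sum>k'\<in>{1..L}. c * (U k k' + W k k'))" if k: "k \<in> {1..L}" for k
  proof -
    note [measurable] = fk[OF k] p_measurable[OF k] Pf[OF k] flow_measurable[OF k]
    have "(\<integral>\<^sup>+x. ennreal (st_density p r (x, k)) * (\<integral>\<^sup>+w. f w \<partial>K (x, k)) \<partial>mu)
       = (\<integral>\<^sup>+x. 1/2 * (ennreal (r k) * (ennreal (p k x) * (\<integral>\<^sup>+y. f (y, k) \<partial>P k x)))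
      + (\<Sum>k'\<in>{1..L}. c * (ennreal (flow k k' x) * f (x, k') + ennreal (r k * p k x - flow k k' x) * f (x, k))) \<partial>mu)"
      unfolding c_def by (rule nn_integral_cong) (simp only: space_mu density_times_kernel[OF _ k f])
    also have "\<dots> = (\<integral>\<^sup>+x. 1/2 * (ennreal (r k) * (ennreal (p k x) * (\<integral>\<^sup>+y. f (y, k) \<partial>P k x))) \<partial>mu)
      + (\<Sum>k'\<in>{1..L}. \<integral>\<^sup>+x. c * (ennreal (flow k k' x) * f (x, k') + ennreal (r k * p k x - flow k k' x) * f (x, k)) \<partial>mu)"
      by (subst nn_integral_add, measurable, subst nn_integral_sum, measurable)
    also have "\<dots> = 1/2 * T k + (\<Sum>k'\<in>{1..L}. c * (U k k' + W k k'))"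
      unfolding U_def W_def
    proof (intro arg_cong2[where f="(+)"] sum.cong refl)
      show "(\<integral>\<^sup>+x. 1/2 * (ennreal (r k) * (ennreal (p k x) * (\<integral>\<^sup>+y. f (y, k) \<partial>P k x))) \<partial>mu) = 1/2 * T k"
        by (subst nn_integral_cmult, measurable) (simp only: Pk[OF k])
      fix k' assume k': "k' \<in> {1..L}"
      note [measurable] = fk[OF k'] flow_measurable[OF k k']
      show "(\<integral>\<^sup>+x. c * (ennreal (flow k k' x) * f (x, k') + ennreal (r k * p k x - flow k k' x) * f (x, k)) \<partial>mu)
         = c * ((\<integral>\<^sup>+x. ennreal (flow k k' x) * f (x, k') \<partial>mu) + (\<integral>\<^sup>+x. ennreal (r k * p k x - flow k k' x) * f (x, k) \<partial>mu))"
        by (subst nn_integral_cmult, measurable, subst nn_integral_add, measurable)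
    qed
    finally show ?thesis .
  qed
  have "(\<integral>\<^sup>+z. ennreal (st_density p r z) * (\<integral>\<^sup>+w. f w \<partial>K z) \<partial>st)
    = (\<Sum>k\<in>{1..L}. 1/2 * T k + (\<Sum>k'\<in>{1..L}. c * (U k k' + W k k')))"
    by (subst nn_integral_st, measurable) (intro sum.cong refl step)
  also have "\<dots> = (\<Sum>k\<in>{1..L}. 1/2 * T k) + (\<Sum>k\<in>{1..L}. \<Sum>k'\<in>{1..L}. c * U k k') + (\<Sum>k\<in>{1..L}. \<Sum>k'\<in>{1..L}. c * W k k')"
    by (simp only: sum.distrib distrib_left add.assoc)
  also have "(\<Sum>k\<in>{1..L}. \<Sum>k'\<in>{1..L}. c * U k k') = (\<Sum>k\<in>{1..L}. \<Sum>k'\<in>{1..L}. c * U k' k)"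
    by (rule sum.swap)
  also have "(\<Sum>k\<in>{1..L}. 1/2 * T k) + (\<Sum>k\<in>{1..L}. \<Sum>k'\<in>{1..L}. c * U k' k) + (\<Sum>k\<in>{1..L}. \<Sum>k'\<in>{1..L}. c * W k k')
    = (\<Sum>k\<in>{1..L}. 1/2 * T k + (\<Sum>k'\<in>{1..L}. c * (U k' k + W k k')))"
    by (simp only: sum.distrib distrib_left add.assoc)
  also have "\<dots> = (\<Sum>k\<in>{1..L}. 1/2 * T k + (\<Sum>k'\<in>{1..L}. c) * T k)"
    unfolding sum_distrib_right
    by (intro sum.cong refl arg_cong2[where f="(+)"] arg_cong[where f="(*) c"] UW)
  also have "\<dots> = (\<Sum>k\<in>{1..L}. T k)"
  proof (intro sum.cong refl)
    fix k
    show "1/2 * T k + (\<Sum>k'\<in>{1..L}. c) * T k = T k"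
      unfolding c_def inverse_twice_L using half_plus_half_ennreal by (metis distrib_right mult_1)
  qed
  also have "\<dots> = (\<integral>\<^sup>+z. ennreal (st_density p r z) * f z \<partial>st)"
    by (subst nn_integral_st, measurable) (simp add: T_def st_density_def)
  finally show "(\<integral>\<^sup>+z. ennreal (st_density p r z) * (\<integral>\<^sup>+w. f w \<partial>K z) \<partial>st) = (\<integral>\<^sup>+z. ennreal (st_density p r z) * f z \<partial>st)" .
qed

text \<open>Rejected level changes contribute (g(x,k) - g(x,k))^2 = 0, which leaves the energy
  inside the levels and the \<open>flow\<close> between them.\<close>

lemma energy_st_ge:
  assumes g[measurable]: "g \<in> borel_measurable st"
  shows "(\<Sum>k\<in>{1..L}. 1/2 * (ennreal (r k) * energy mu (p k) (P k) (\<lambda>x. g (x, k)))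
       + (\<Sum>k'\<in>{1..L}. ennreal (1 / (2 * real L)) * (\<integral>\<^sup>+x. ennreal (flow k k' x * (g (x, k) - g (x, k'))\<^sup>2) \<partial>mu)))
     \<le> energy st (st_density p r) K g"
proof -
  have gk[measurable]: "(\<lambda>x. g (x, k)) \<in> borel_measurable mu" if "k \<in> {1..L}" for k
    by (rule measurable_st_section[OF g that])
  have Kf: "(\<lambda>z. \<integral>\<^sup>+w. ennreal ((g z - g w)\<^sup>2) \<partial>K z) \<in> borel_measurable st"
    by (rule nn_integral_measurable_subprob_algebra2[OF _ markov_kernelD(1)[OF markov_kernel_st]]) measurable
  have "energy st (st_density p r) K g =
     (\<Sum>k\<in>{1..L}. \<integral>\<^sup>+x. ennreal (st_density p r (x, k)) * (\<integral>\<^sup>+w. ennreal ((g (x, k) - g w)\<^sup>2) \<partial>K (x, k)) \<partial>mu)"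
    unfolding energy_def using Kf by (subst nn_integral_st) auto
  moreover have "1/2 * (ennreal (r k) * energy mu (p k) (P k) (\<lambda>x. g (x, k)))
       + (\<Sum>k'\<in>{1..L}. ennreal (1 / (2 * real L)) * (\<integral>\<^sup>+x. ennreal (flow k k' x * (g (x, k) - g (x, k'))\<^sup>2) \<partial>mu))
     \<le> (\<integral>\<^sup>+x. ennreal (st_density p r (x, k)) * (\<integral>\<^sup>+w. ennreal ((g (x, k) - g w)\<^sup>2) \<partial>K (x, k)) \<partial>mu)"
    if k: "k \<in> {1..L}" for k
  proof -
    note [measurable] = gk[OF k] p_measurable[OF k] flow_measurable[OF k]
    have [measurable]: "(\<lambda>x. \<integral>\<^sup>+y. ennreal ((g (x, k) - g (y, k))\<^sup>2) \<partial>P k x) \<in> borel_measurable mu"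
      by (rule nn_integral_measurable_subprob_algebra2[OF _ markov_kernelD(1)[OF kernel[OF k]]]) measurable
    have "1/2 * (ennreal (r k) * energy mu (p k) (P k) (\<lambda>x. g (x, k)))
       + (\<Sum>k'\<in>{1..L}. ennreal (1 / (2 * real L)) * (\<integral>\<^sup>+x. ennreal (flow k k' x * (g (x, k) - g (x, k'))\<^sup>2) \<partial>mu))
      = (\<integral>\<^sup>+x. 1/2 * (ennreal (r k) * (ennreal (p k x) * (\<integral>\<^sup>+y. ennreal ((g (x, k) - g (y, k))\<^sup>2) \<partial>P k x)))
       + (\<Sum>k'\<in>{1..L}. ennreal (1 / (2 * real L)) * ennreal (flow k k' x * (g (x, k) - g (x, k'))\<^sup>2)) \<partial>mu)"
      unfolding energy_def
      by (simp add: nn_integral_add nn_integral_sum nn_integral_cmult del: sum_constant atLeastAtMost_iff)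
    also have "\<dots> \<le> (\<integral>\<^sup>+x. ennreal (st_density p r (x, k)) * (\<integral>\<^sup>+w. ennreal ((g (x, k) - g w)\<^sup>2) \<partial>K (x, k)) \<partial>mu)"
    proof (rule nn_integral_mono)
      fix x assume "x \<in> space mu"
      then have x: "x \<in> \<Omega>" by simp
      show "1/2 * (ennreal (r k) * (ennreal (p k x) * (\<integral>\<^sup>+y. ennreal ((g (x, k) - g (y, k))\<^sup>2) \<partial>P k x)))
       + (\<Sum>k'\<in>{1..L}. ennreal (1 / (2 * real L)) * ennreal (flow k k' x * (g (x, k) - g (x, k'))\<^sup>2))
        \<le> ennreal (st_density p r (x, k)) * (\<integral>\<^sup>+w. ennreal ((g (x, k) - g w)\<^sup>2) \<partial>K (x, k))"
      proof (subst density_times_kernel[OF x k], measurable, intro add_mono order_refl sum_mono mult_left_mono)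
        fix k' assume k': "k' \<in> {1..L}"
        show "ennreal (flow k k' x * (g (x, k) - g (x, k'))\<^sup>2) \<le> ennreal (flow k k' x) * ennreal ((g (x, k) - g (x, k'))\<^sup>2)
           + ennreal (r k * p k x - flow k k' x) * ennreal ((g (x, k) - g (x, k))\<^sup>2)"
          using flow_bounds[OF x k k'] by (simp add: ennreal_mult)
      qed simp
    qed
    finally show ?thesis .
  qed
  ultimately show ?thesis by (simp only: sum_mono)
qed

end

section \<open>Comparison of block means\<close>

lemma square_sum3_le: "((a::real) + b + c)\<^sup>2 \<le> 3 * (a\<^sup>2 + b\<^sup>2 + c\<^sup>2)"
  using zero_le_power2[of "a - b"] zero_le_power2[of "b - c"] zero_le_power2[of "a - c"]
  by (simp add: power2_eq_square algebra_simps)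

locale tempering_partition = tempering +
  fixes Part :: "nat \<Rightarrow> 'a set set"
  assumes part: "\<And>i. i \<in> {1..L} \<Longrightarrow> is_partition \<Omega> (Part i)"
    and part_pos: "\<And>i A. i \<in> {1..L} \<Longrightarrow> A \<in> Part i \<Longrightarrow> mass lborel (p i) A > 0"
    and part_1: "Part 1 = {\<Omega>}"
begin

section \<open>Blocks and their masses\<close>

lemma
  assumes i: "i \<in> {1..L}"
  shows finite_Part: "finite (Part i)"
    and Part_subset: "A \<in> Part i \<Longrightarrow> A \<subseteq> \<Omega>"
    and Part_sets: "A \<in> Part i \<Longrightarrow> A \<in> sets mu"
    and Part_cover: "x \<in> \<Omega> \<Longrightarrow> \<exists>A\<in>Part i. x \<in> A"
proof -
  note pt = part[OF i, unfolded is_partition_def]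
  show "finite (Part i)" using pt by blast
  show sub: "A \<subseteq> \<Omega>" if "A \<in> Part i" for A using pt that by blast
  show "A \<in> sets mu" if "A \<in> Part i"
  proof -
    have "A \<in> sets lborel" using pt that by blast
    then show ?thesis unfolding state_space_def using \<Omega> sub[OF that]
      by (subst sets_restrict_space_iff) simp_all
  qed
  have "\<Union>(Part i) = \<Omega>" using pt by (elim conjE)
  then show "\<exists>A\<in>Part i. x \<in> A" if "x \<in> \<Omega>" using that by (simp only: Union_iff flip: \<open>\<Union>(Part i) = \<Omega>\<close>)
qed

text \<open>Masses and overlaps in the theorem are integrals over the whole space, while the
  densities are controlled on \<Omega> only; the indicator of a block hides the rest.\<close>

lemma integral_mu_indicator:
  assumes "A \<subseteq> \<Omega>"
  shows "(\<integral>x. indicator A x * f x \<partial>mu) = (\<integral>x. indicator A x * (f x :: real) \<partial>lborel)"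
proof -
  have "(\<integral>x. indicator A x * f x \<partial>mu) = (\<integral>x. indicator \<Omega> x *\<^sub>R (indicator A x * f x) \<partial>lborel)"
    unfolding state_space_def using \<Omega> by (intro integral_restrict_space) simp
  also have "\<dots> = (\<integral>x. indicator A x * f x \<partial>lborel)"
    using assms by (intro Bochner_Integration.integral_cong) (auto split: split_indicator)
  finally show ?thesis .
qed

lemma mass_mu_eq: "i \<in> {1..L} \<Longrightarrow> A \<in> Part i \<Longrightarrow> mass mu q A = mass lborel q A"
  unfolding mass_def by (rule integral_mu_indicator[OF Part_subset])

lemma mass_le_1:
  assumes i: "i \<in> {1..L}" and A: "A \<in> Part i"
  shows "mass lborel (p i) A \<le> 1"
proof -
  have "mass mu (p i) A \<le> (\<integral>x. p i x \<partial>mu)"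
    unfolding mass_def
  proof (rule integral_mono)
    show "integrable mu (\<lambda>x. indicator A x * p i x)"
      using integrable_mult_indicator[OF Part_sets[OF i A] prob_densityD(3)[OF dens[OF i]]] by simp
  qed (use prob_densityD(3)[OF dens[OF i]] p_nonneg[OF i] in \<open>auto split: split_indicator\<close>)
  then show ?thesis using prob_densityD(4)[OF dens[OF i]] mass_mu_eq[OF i A] by simp
qed

lemma AE_Part_disjoint:
  assumes i: "i \<in> {1..L}"
  shows "AE x in mu. (\<Sum>A\<in>Part i. indicator A x) \<le> (1::ennreal)"
proof -
  have pt: "is_partition \<Omega> (Part i)" by (rule part[OF i])
  have "AE x in lborel. \<forall>A\<in>Part i. \<forall>B\<in>Part i. A \<noteq> B \<longrightarrow> x \<notin> A \<inter> B"
  proof (intro AE_finite_allI finite_Part[OF i])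
    fix A B assume AB: "A \<in> Part i" "B \<in> Part i"
    show "AE x in lborel. A \<noteq> B \<longrightarrow> x \<notin> A \<inter> B"
    proof (cases "A = B")
      case False
      then have "A \<inter> B \<in> null_sets lborel"
        using pt AB unfolding is_partition_def by (intro null_setsI) auto
      then have "AE x in lborel. x \<notin> A \<inter> B" by (rule AE_not_in)
      then show ?thesis by (rule eventually_mono) simp
    qed simp
  qed
  then have "AE x in mu. \<forall>A\<in>Part i. \<forall>B\<in>Part i. A \<noteq> B \<longrightarrow> x \<notin> A \<inter> B"
    unfolding state_space_def using \<Omega> by (subst AE_restrict_space_iff) (auto elim!: eventually_mono)
  then show ?thesis
  proof eventually_elim
    case (elim x)
    show ?case
    proof (cases "\<exists>A\<in>Part i. x \<in> A")
      case True
      then obtain A where A: "A \<in> Part i" "x \<in> A" by blast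
      have "(\<Sum>B\<in>Part i. indicator B x :: ennreal) = (\<Sum>B\<in>Part i. if B = A then 1 else 0)"
        using elim A by (intro sum.cong) (auto simp: indicator_def)
      also have "\<dots> = 1" using A finite_Part[OF i] by simp
      finally show ?thesis by simp
    next
      case False
      then have "(\<Sum>B\<in>Part i. indicator B x :: ennreal) = 0" by (intro sum.neutral) auto
      then show ?thesis by simp
    qed
  qed
qed

section \<open>Nonconstant test functions and an upper bound on the gap\<close>

lemma arctan_inner_st:
  assumes b: "b \<noteq> 0"
  defines "g \<equiv> \<lambda>z. arctan (b \<bullet> fst z)"
  shows "L2 st (st_density p r) g" "0 < var_pi st (st_density p r) g"
proof -
  have gk[measurable]: "(\<lambda>x. arctan (b \<bullet> x)) \<in> borel_measurable mu"
    unfolding state_space_def by (rule measurable_restrict_space1) measurable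
  have gm[measurable]: "g \<in> borel_measurable st"
    by (rule measurable_st) (simp add: g_def)
  note q = prob_density_st
  have "integrable st (\<lambda>z. (g z)\<^sup>2 * st_density p r z)"
  proof (rule Bochner_Integration.integrable_bound)
    show "integrable st (\<lambda>z. pi\<^sup>2 * st_density p r z)" using prob_densityD(3)[OF q] by simp
    show "AE z in st. norm ((g z)\<^sup>2 * st_density p r z) \<le> norm (pi\<^sup>2 * st_density p r z)"
    proof (rule AE_I2)
      fix z
      have "\<bar>g z\<bar> \<le> \<bar>pi\<bar>" unfolding g_def using arctan_lbound[of "b \<bullet> fst z"] arctan_ubound[of "b \<bullet> fst z"] pi_gt_zero by linarith
      then have "(g z)\<^sup>2 \<le> pi\<^sup>2" by (simp only: abs_le_square_iff)
      then show "norm ((g z)\<^sup>2 * st_density p r z) \<le> norm (pi\<^sup>2 * st_density p r z)"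
        by (simp add: abs_mult mult_right_mono)
    qed
  qed measurable
  then show g: "L2 st (st_density p r) g" by (simp add: L2_def)
  define c where "c = (\<integral>y. g y * st_density p r y \<partial>st)"
  have 1: "1 \<in> {1..L}" using L by simp
  note [measurable] = p_measurable[OF 1]
  \<comment> \<open>Since g depends on x, the level 1 term alone gives positive deviation from any
    centre. A function of the level alone would be constant for L = 1.\<close>
  have "0 < ennreal (r 1) * (\<integral>\<^sup>+x. ennreal (p 1 x * (arctan (b \<bullet> x) - c)\<^sup>2) \<partial>mu)"
    using variance_arctan_inner_pos[OF \<Omega> dens[OF 1] b] r_pos[OF 1] by (simp add: ennreal_zero_less_mult_iff)
  also have "\<dots> = (\<integral>\<^sup>+x. ennreal (r 1) * ennreal (p 1 x * (arctan (b \<bullet> x) - c)\<^sup>2) \<partial>mu)"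
    by (rule nn_integral_cmult[symmetric]) measurable
  also have "\<dots> = (\<integral>\<^sup>+x. ennreal (st_density p r (x, 1) * (g (x, 1) - c)\<^sup>2) \<partial>mu)"
    using r_pos[OF 1] p_nonneg[OF 1]
    by (intro nn_integral_cong) (simp only: st_density_def g_def mult.assoc prod.case fst_conv space_mu
        ennreal_mult less_imp_le mult_nonneg_nonneg zero_le_power2)
  also have "\<dots> \<le> (\<Sum>k\<in>{1..L}. \<integral>\<^sup>+x. ennreal (st_density p r (x, k) * (g (x, k) - c)\<^sup>2) \<partial>mu)"
    using 1 by (intro member_le_sum) auto
  also have "\<dots> = (\<integral>\<^sup>+z. ennreal (st_density p r z * (g z - c)\<^sup>2) \<partial>st)"
    by (rule nn_integral_st[symmetric]) measurable
  also have "\<dots> = ennreal (var_pi st (st_density p r) g)"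
    unfolding c_def by (rule var_pi_eq(1)[OF q g, symmetric])
  finally show "0 < var_pi st (st_density p r) g" by simp
qed

text \<open>Level 1 has the single block \<Omega>, so its restricted Poincare inequality meets the
  upper bound \<open>energy_le_variance\<close> for the same function and the same centre m. For the
  arctan function the deviation \<open>?X\<close> is positive and finite, and can be
  cancelled.\<close>

lemma restricted_gap_le_2:
  assumes \<gamma>: "0 \<le> \<gamma>" "\<gamma> \<le> restricted_gap mu (p 1) (P 1) \<Omega>"
  shows "\<gamma> \<le> 2"
proof -
  have 1: "1 \<in> {1..L}" and \<Omega>1: "\<Omega> \<in> Part 1" using L part_1 by auto
  obtain b :: 'a where b: "b \<noteq> 0" using nonzero_Basis SOME_Basis by blast
  let ?g = "\<lambda>x. arctan (b \<bullet> x)"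
  have gL: "L2 mu (p 1) ?g" using L2_section[OF arctan_inner_st(1)[OF b] 1] by simp
  have gm: "?g \<in> borel_measurable mu" using gL by (simp add: L2_def)
  note stat = reversible_imp_nn_stationary[OF kernel[OF 1] dens[OF 1] rev[OF 1]]
  have "mass mu (p 1) \<Omega> > 0" using part_pos[OF 1 \<Omega>1] mass_mu_eq[OF 1 \<Omega>1] by simp
  from restricted_gap_poincare[OF kernel[OF 1] dens[OF 1] rev[OF 1] Part_sets[OF 1 \<Omega>1] this gL \<gamma>]
  obtain m where m: "ennreal (2 * \<gamma>) * (\<integral>\<^sup>+x. indicator \<Omega> x * ennreal (p 1 x * (?g x - m)\<^sup>2) \<partial>mu)
     \<le> (\<integral>\<^sup>+x. indicator \<Omega> x * (ennreal (p 1 x) * (\<integral>\<^sup>+y. indicator \<Omega> y * ennreal ((?g x - ?g y)\<^sup>2) \<partial>P 1 x)) \<partial>mu)"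
    by blast
  note [measurable] = p_measurable[OF 1]
  let ?X = "\<integral>\<^sup>+x. ennreal (p 1 x * (?g x - m)\<^sup>2) \<partial>mu"
  have "(\<integral>\<^sup>+x. indicator \<Omega> x * ennreal (p 1 x * (?g x - m)\<^sup>2) \<partial>mu) = ?X"
    by (intro nn_integral_cong) simp
  then have "ennreal (2 * \<gamma>) * ?X \<le> (\<Sum>A\<in>{\<Omega>}. \<integral>\<^sup>+x. indicator A x * (ennreal (p 1 x) * (\<integral>\<^sup>+y. indicator A y * ennreal ((?g x - ?g y)\<^sup>2) \<partial>P 1 x)) \<partial>mu)"
    using m by simp
  also have "\<dots> \<le> energy mu (p 1) (P 1) ?g"
    using Part_sets[OF 1 \<Omega>1] by (intro sum_block_energy_le kernel 1 gm p_measurable) (auto simp: indicator_def)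
  also have "\<dots> \<le> 4 * ?X" by (rule energy_le_variance[OF kernel[OF 1] dens[OF 1] stat gm])
  finally have le: "ennreal (2 * \<gamma>) * ?X \<le> ennreal 4 * ?X" by simp
  have pos: "?X \<noteq> 0" using variance_arctan_inner_pos[OF \<Omega> dens[OF 1] b, of m] by simp
  have "?X \<le> (\<integral>\<^sup>+x. ennreal ((pi + \<bar>m\<bar>)\<^sup>2) * ennreal (p 1 x) \<partial>mu)"
  proof (rule nn_integral_mono)
    fix x assume x: "x \<in> space mu"
    have "\<bar>?g x - m\<bar> \<le> \<bar>pi + \<bar>m\<bar>\<bar>"
      using arctan_lbound[of "b \<bullet> x"] arctan_ubound[of "b \<bullet> x"] pi_gt_zero by linarith
    then have "(?g x - m)\<^sup>2 \<le> (pi + \<bar>m\<bar>)\<^sup>2" by (simp only: abs_le_square_iff)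
    then have "p 1 x * (?g x - m)\<^sup>2 \<le> (pi + \<bar>m\<bar>)\<^sup>2 * p 1 x"
      using p_nonneg[OF 1, of x] x by (simp only: space_mu mult.commute[of "p 1 x"] mult_right_mono)
    then show "ennreal (p 1 x * (?g x - m)\<^sup>2) \<le> ennreal ((pi + \<bar>m\<bar>)\<^sup>2) * ennreal (p 1 x)"
      using p_nonneg[OF 1] x by (simp add: ennreal_leI flip: ennreal_mult)
  qed
  also have "\<dots> = ennreal ((pi + \<bar>m\<bar>)\<^sup>2)"
    by (subst nn_integral_cmult, measurable) (simp only: prob_densityD(5)[OF dens[OF 1]] mult_1_right)
  finally have "?X < \<top>" by (rule le_less_trans) simp
  then have fin: "?X \<noteq> \<top>" by simp
  have "?X * ennreal (2 * \<gamma>) \<le> ?X * ennreal 4" using le by (simp add: mult.commute)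
  then have "ennreal (2 * \<gamma>) \<le> ennreal 4"
    using pos fin by (subst (asm) ennreal_mult_le_mult_iff) auto
  then have "2 * \<gamma> \<le> 4" by (subst (asm) ennreal_le_iff) simp_all
  then show ?thesis by simp
qed

section \<open>Within-block and between-level deviations\<close>

definition block_dev :: "(nat \<Rightarrow> 'a set \<Rightarrow> real) \<Rightarrow> ('a \<times> nat \<Rightarrow> real) \<Rightarrow> nat \<Rightarrow> 'a \<Rightarrow> real" where
  "block_dev m g i x = (\<Sum>A\<in>Part i. indicator A x * (g (x, i) - m i A)\<^sup>2)"

definition within_dev :: "(nat \<Rightarrow> 'a set \<Rightarrow> real) \<Rightarrow> ('a \<times> nat \<Rightarrow> real) \<Rightarrow> nat \<Rightarrow> ennreal" where
  "within_dev m g i = (\<integral>\<^sup>+x. ennreal (p i x * block_dev m g i x) \<partial>mu)"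

definition level_dev :: "('a \<times> nat \<Rightarrow> real) \<Rightarrow> nat \<Rightarrow> ennreal" where
  "level_dev g i = (\<integral>\<^sup>+x. ennreal (min (p (i - 1) x) (p i x) * (g (x, i) - g (x, i - 1))\<^sup>2) \<partial>mu)"

lemma block_dev_nonneg: "0 \<le> block_dev m g i x"
  unfolding block_dev_def by (intro sum_nonneg) simp

text \<open>Where blocks overlap, \<open>block_dev\<close> adds the terms of all blocks containing
  x, so the bound is available for each of them and no block has to be selected for x.\<close>

lemma block_dev_ge:
  assumes i: "i \<in> {1..L}" and A: "A \<in> Part i" and x: "x \<in> A"
  shows "(g (x, i) - m i A)\<^sup>2 \<le> block_dev m g i x"
  using member_le_sum[OF A, of "\<lambda>A. indicator A x * (g (x, i) - m i A)\<^sup>2"] finite_Part[OF i] x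
  unfolding block_dev_def by simp

lemma block_dev_measurable:
  assumes g: "g \<in> borel_measurable st" and i: "i \<in> {1..L}"
  shows "block_dev m g i \<in> borel_measurable mu"
proof -
  note [measurable] = measurable_st_section[OF g i] Part_sets[OF i]
  show ?thesis unfolding block_dev_def by measurable
qed

text \<open>The centres, chosen by \<open>SOME\<close> from the blockwise inequalities, are
  collected in one function m for all levels, because the descent compares centres of neighbouring
  levels.\<close>

lemma within_dev_le_energy:
  assumes g: "L2 st (st_density p r) g" and \<gamma>: "0 \<le> \<gamma>"
    and gap: "\<And>i A. i \<in> {1..L} \<Longrightarrow> A \<in> Part i \<Longrightarrow> \<gamma> \<le> restricted_gap mu (p i) (P i) A"
  shows "\<exists>m. \<forall>i\<in>{1..L}. ennreal (2 * \<gamma>) * within_dev m g i \<le> energy mu (p i) (P i) (\<lambda>x. g (x, i))"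
proof -
  let ?X = "\<lambda>i A c. \<integral>\<^sup>+x. indicator A x * ennreal (p i x * (g (x, i) - c)\<^sup>2) \<partial>mu"
  let ?Y = "\<lambda>i A. \<integral>\<^sup>+x. indicator A x * (ennreal (p i x) * (\<integral>\<^sup>+y. indicator A y * ennreal ((g (x, i) - g (y, i))\<^sup>2) \<partial>P i x)) \<partial>mu"
  have ex: "\<exists>c. ennreal (2 * \<gamma>) * ?X i A c \<le> ?Y i A" if i: "i \<in> {1..L}" and A: "A \<in> Part i" for i A
    using part_pos[OF i A] mass_mu_eq[OF i A]
    by (intro restricted_gap_poincare[OF kernel[OF i] dens[OF i] rev[OF i] Part_sets[OF i A] _ L2_section[OF g i] \<gamma> gap[OF i A]]) simp
  define m where "m i A = (SOME c. ennreal (2 * \<gamma>) * ?X i A c \<le> ?Y i A)" for i A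
  have m: "ennreal (2 * \<gamma>) * ?X i A (m i A) \<le> ?Y i A" if "i \<in> {1..L}" "A \<in> Part i" for i A
    unfolding m_def by (rule someI_ex[OF ex[OF that]])
  have gm: "g \<in> borel_measurable st" using g by (simp add: L2_def)
  have "ennreal (2 * \<gamma>) * within_dev m g i \<le> energy mu (p i) (P i) (\<lambda>x. g (x, i))" if i: "i \<in> {1..L}" for i
  proof -
    note [measurable] = measurable_st_section[OF gm i] Part_sets[OF i] p_measurable[OF i]
    have "within_dev m g i = (\<integral>\<^sup>+x. (\<Sum>A\<in>Part i. indicator A x * ennreal (p i x * (g (x, i) - m i A)\<^sup>2)) \<partial>mu)"
      unfolding within_dev_def
    proof (rule nn_integral_cong)
      fix x assume x: "x \<in> space mu"
      have "p i x * block_dev m g i x = (\<Sum>A\<in>Part i. indicator A x * (p i x * (g (x, i) - m i A)\<^sup>2))"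
        by (simp add: block_dev_def sum_distrib_left ac_simps)
      also have "ennreal \<dots> = (\<Sum>A\<in>Part i. ennreal (indicator A x * (p i x * (g (x, i) - m i A)\<^sup>2)))"
        using x p_nonneg[OF i] by (intro sum_ennreal[symmetric]) simp
      also have "\<dots> = (\<Sum>A\<in>Part i. indicator A x * ennreal (p i x * (g (x, i) - m i A)\<^sup>2))"
        by (intro sum.cong) (auto split: split_indicator)
      finally show "ennreal (p i x * block_dev m g i x) = (\<Sum>A\<in>Part i. indicator A x * ennreal (p i x * (g (x, i) - m i A)\<^sup>2))" .
    qed
    also have "\<dots> = (\<Sum>A\<in>Part i. ?X i A (m i A))"
      by (rule nn_integral_sum) measurable
    finally have "ennreal (2 * \<gamma>) * within_dev m g i = (\<Sum>A\<in>Part i. ennreal (2 * \<gamma>) * ?X i A (m i A))"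
      by (simp add: sum_distrib_left)
    also have "\<dots> \<le> (\<Sum>A\<in>Part i. ?Y i A)" by (intro sum_mono m i)
    also have "\<dots> \<le> energy mu (p i) (P i) (\<lambda>x. g (x, i))"
      by (intro sum_block_energy_le kernel i p_measurable measurable_st_section[OF gm] finite_Part Part_sets[OF i] AE_Part_disjoint)
    finally show ?thesis .
  qed
  then show ?thesis by blast
qed

text \<open>The within-block coefficient is 1/2, the probability of a move inside the level, times
  \<rho> times 2 \<gamma>. Of the L proposals from level k only k' = k - 1 is kept, with weight 1 /
  (2 L) and a \<open>flow\<close> of at least \<rho> times the overlap density.\<close>

lemma energy_st_ge_devs:
  assumes g: "g \<in> borel_measurable st" and \<gamma>: "0 \<le> \<gamma>"
    and within_dev: "\<And>i. i \<in> {1..L} \<Longrightarrow> ennreal (2 * \<gamma>) * within_dev m g i \<le> energy mu (p i) (P i) (\<lambda>x. g (x, i))"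
    and \<rho>: "0 < \<rho>" "\<And>i. i \<in> {1..L} \<Longrightarrow> \<rho> \<le> r i"
  shows "(\<Sum>k\<in>{1..L}. ennreal (\<rho> * \<gamma>) * within_dev m g k) + (\<Sum>k\<in>{2..L}. ennreal (\<rho> / (2 * real L)) * level_dev g k)
     \<le> energy st (st_density p r) K g"
proof -
  let ?E = "\<lambda>k. 1/2 * (ennreal (r k) * energy mu (p k) (P k) (\<lambda>x. g (x, k)))"
  let ?D = "\<lambda>k k'. ennreal (1 / (2 * real L)) * (\<integral>\<^sup>+x. ennreal (flow k k' x * (g (x, k) - g (x, k'))\<^sup>2) \<partial>mu)"
  have E: "ennreal (\<rho> * \<gamma>) * within_dev m g k \<le> ?E k" if k: "k \<in> {1..L}" for k
  proof -
    have "ennreal (\<rho> * \<gamma>) = ennreal (1/2 * (\<rho> * (2 * \<gamma>)))" by simp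
    also have "\<dots> = ennreal (1/2) * (ennreal \<rho> * ennreal (2 * \<gamma>))"
      using \<rho>(1) \<gamma> by (subst ennreal_mult, simp, simp, subst ennreal_mult, simp_all only: less_imp_le mult_nonneg_nonneg zero_le_numeral)
    finally have "ennreal (\<rho> * \<gamma>) = ennreal (1/2) * (ennreal \<rho> * ennreal (2 * \<gamma>))" .
    then have "ennreal (\<rho> * \<gamma>) * within_dev m g k = 1/2 * (ennreal \<rho> * (ennreal (2 * \<gamma>) * within_dev m g k))"
      by (simp only: half_ennreal mult.assoc)
    also have "\<dots> \<le> ?E k"
      using \<rho>(2)[OF k] by (intro mult_left_mono[of _ _ "1/2"] mult_mono within_dev k ennreal_leI) auto
    finally show ?thesis .
  qed
  have D: "ennreal (\<rho> / (2 * real L)) * level_dev g k \<le> (\<Sum>k'\<in>{1..L}. ?D k k')" if k: "k \<in> {2..L}" for k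
  proof -
    have k1: "k \<in> {1..L}" "k - 1 \<in> {1..L}" using k by auto
    note [measurable] = measurable_st_section[OF g k1(1)] measurable_st_section[OF g k1(2)]
      p_measurable[OF k1(1)] p_measurable[OF k1(2)]
    have "ennreal (\<rho> / (2 * real L)) = ennreal (1 / (2 * real L)) * ennreal \<rho>"
      using \<rho> by (simp flip: ennreal_mult)
    then have "ennreal (\<rho> / (2 * real L)) * level_dev g k = ennreal (1 / (2 * real L)) *
        (\<integral>\<^sup>+x. ennreal \<rho> * ennreal (min (p (k - 1) x) (p k x) * (g (x, k) - g (x, k - 1))\<^sup>2) \<partial>mu)"
      unfolding level_dev_def by (subst nn_integral_cmult, measurable) (simp only: mult.assoc)
    also have "\<dots> \<le> ?D k (k - 1)"
    proof (intro mult_left_mono nn_integral_mono)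
      fix x assume "x \<in> space mu"
      then have x: "x \<in> \<Omega>" by simp
      have "\<rho> * min (p (k - 1) x) (p k x) \<le> flow k (k - 1) x"
      proof -
        have "\<rho> * min (p (k - 1) x) (p k x) \<le> r k * p k x"
          using less_imp_le[OF r_pos[OF k1(1)]] less_imp_le[OF r_pos[OF k1(2)]] p_nonneg[OF k1(1) x] p_nonneg[OF k1(2) x]
          by (intro mult_mono \<rho> k1) auto
        moreover have "\<rho> * min (p (k - 1) x) (p k x) \<le> r (k - 1) * p (k - 1) x"
          using less_imp_le[OF r_pos[OF k1(1)]] less_imp_le[OF r_pos[OF k1(2)]] p_nonneg[OF k1(1) x] p_nonneg[OF k1(2) x]
          by (intro mult_mono \<rho> k1) auto
        ultimately show ?thesis by (simp add: flow_def)
      qed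
      then have "\<rho> * (min (p (k - 1) x) (p k x) * (g (x, k) - g (x, k - 1))\<^sup>2) \<le> flow k (k - 1) x * (g (x, k) - g (x, k - 1))\<^sup>2"
        by (simp only: mult.assoc[symmetric]) (rule mult_right_mono, auto)
      then show "ennreal \<rho> * ennreal (min (p (k - 1) x) (p k x) * (g (x, k) - g (x, k - 1))\<^sup>2)
          \<le> ennreal (flow k (k - 1) x * (g (x, k) - g (x, k - 1))\<^sup>2)"
        using \<rho>(1) by (simp add: ennreal_leI flip: ennreal_mult')
    qed simp
    also have "\<dots> \<le> (\<Sum>k'\<in>{1..L}. ?D k k')"
      by (rule member_le_sum[OF k1(2)]) auto
    finally show ?thesis .
  qed
  have "(\<Sum>k\<in>{1..L}. ennreal (\<rho> * \<gamma>) * within_dev m g k) + (\<Sum>k\<in>{2..L}. ennreal (\<rho> / (2 * real L)) * level_dev g k)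
    \<le> (\<Sum>k\<in>{1..L}. ?E k) + (\<Sum>k\<in>{2..L}. \<Sum>k'\<in>{1..L}. ?D k k')"
    by (intro add_mono sum_mono E D)
  also have "\<dots> \<le> (\<Sum>k\<in>{1..L}. ?E k) + (\<Sum>k\<in>{1..L}. \<Sum>k'\<in>{1..L}. ?D k k')"
    by (intro add_mono order_refl sum_mono2) auto
  also have "\<dots> = (\<Sum>k\<in>{1..L}. ?E k + (\<Sum>k'\<in>{1..L}. ?D k k'))" by (rule sum.distrib[symmetric])
  also have "\<dots> \<le> energy st (st_density p r) K g" by (rule energy_st_ge[OF g])
  finally show ?thesis .
qed

text \<open>The block of level i - 1 that contains x varies with x in A. Choosing B with centre
  closest to \<open>m i A\<close> among all blocks turns this into one bound c \<le>
  \<open>?H x\<close> on all of A, which is then integrated against the overlap density. The 3 comes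
  from splitting the difference of centres at g(x,i) and g(x,i-1).\<close>

lemma close_block_below:
  assumes g: "g \<in> borel_measurable st" and i: "i \<in> {2..L}" and A: "A \<in> Part i"
    and w: "0 < w" "w \<le> (\<integral>x. indicator A x * min (p (i - 1) x) (p i x) \<partial>lborel)"
    and s: "0 \<le> s" "within_dev m g i + level_dev g i + within_dev m g (i - 1) \<le> ennreal s"
  shows "\<exists>B\<in>Part (i - 1). (m i A - m (i - 1) B)\<^sup>2 \<le> 3 * s / w"
proof -
  have k: "i \<in> {1..L}" "i - 1 \<in> {1..L}" using i by auto
  note [measurable] = measurable_st_section[OF g k(1)] measurable_st_section[OF g k(2)]
    p_measurable[OF k(1)] p_measurable[OF k(2)] block_dev_measurable[OF g k(1)] block_dev_measurable[OF g k(2)]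
    Part_sets[OF k(1) A]
  let ?w = "\<lambda>x. min (p (i - 1) x) (p i x)"
  have wnn: "0 \<le> ?w x" if "x \<in> \<Omega>" for x using p_nonneg[OF k(1) that] p_nonneg[OF k(2) that] by simp
  have "A \<noteq> {}" using part_pos[OF k(1) A] by (auto simp: mass_def)
  then have "Part (i - 1) \<noteq> {}" using Part_subset[OF k(1) A] Part_cover[OF k(2)] by fast
  then obtain B where B: "B \<in> Part (i - 1)"
    and min: "\<And>B'. B' \<in> Part (i - 1) \<Longrightarrow> (m i A - m (i - 1) B)\<^sup>2 \<le> (m i A - m (i - 1) B')\<^sup>2"
    using arg_min_if_finite[OF finite_Part[OF k(2)], of "\<lambda>B. (m i A - m (i - 1) B)\<^sup>2"] by (meson not_le)
  define c where "c = (m i A - m (i - 1) B)\<^sup>2 / 3"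
  have c0: "0 \<le> c" by (simp add: c_def)
  let ?H = "\<lambda>x. block_dev m g i x + (g (x, i) - g (x, i - 1))\<^sup>2 + block_dev m g (i - 1) x"
  have H: "c \<le> ?H x" if x: "x \<in> A" for x
  proof -
    obtain B' where B': "B' \<in> Part (i - 1)" "x \<in> B'"
      using Part_cover[OF k(2)] Part_subset[OF k(1) A] x by blast
    have "(m i A - m (i - 1) B)\<^sup>2 \<le> (m i A - m (i - 1) B')\<^sup>2" by (rule min[OF B'(1)])
    also have "\<dots> = ((m i A - g (x, i)) + (g (x, i) - g (x, i - 1)) + (g (x, i - 1) - m (i - 1) B'))\<^sup>2" by simp
    also have "\<dots> \<le> 3 * ((m i A - g (x, i))\<^sup>2 + (g (x, i) - g (x, i - 1))\<^sup>2 + (g (x, i - 1) - m (i - 1) B')\<^sup>2)"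
      by (rule square_sum3_le)
    also have "\<dots> \<le> 3 * ?H x"
      using block_dev_ge[OF k(1) A x, of g m] block_dev_ge[OF k(2) B', of g m]
      by (simp add: power2_commute[of "m i A"])
    finally show ?thesis by (simp add: c_def)
  qed
  have wi: "integrable mu (\<lambda>x. indicator A x * ?w x)"
  proof (rule Bochner_Integration.integrable_bound[OF prob_densityD(3)[OF dens[OF k(1)]]])
    show "AE x in mu. norm (indicator A x * ?w x) \<le> norm (p i x)"
      using wnn by (intro AE_I2) (auto split: split_indicator)
  qed measurable
  have "ennreal (w * c) \<le> ennreal ((\<integral>x. indicator A x * ?w x \<partial>mu) * c)"
    using w(2) by (intro ennreal_leI mult_right_mono)
      (auto simp: c_def integral_mu_indicator[OF Part_subset[OF k(1) A]])
  also have "\<dots> = (\<integral>\<^sup>+x. ennreal (indicator A x * ?w x) \<partial>mu) * ennreal c"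
    using wnn c0 by (subst nn_integral_eq_integral[OF wi]) (auto intro: ennreal_mult'')
  also have "\<dots> = (\<integral>\<^sup>+x. ennreal (indicator A x * ?w x) * ennreal c \<partial>mu)"
    by (rule nn_integral_multc[symmetric]) measurable
  also have "\<dots> \<le> (\<integral>\<^sup>+x. ennreal (p i x * block_dev m g i x)
      + ennreal (?w x * (g (x, i) - g (x, i - 1))\<^sup>2) + ennreal (p (i - 1) x * block_dev m g (i - 1) x) \<partial>mu)"
  proof (rule nn_integral_mono)
    fix x assume "x \<in> space mu"
    then have x: "x \<in> \<Omega>" by simp
    note nn = wnn[OF x] p_nonneg[OF k(1) x] p_nonneg[OF k(2) x] block_dev_nonneg[of m g i x] block_dev_nonneg[of m g "i - 1" x]
    have "indicator A x * ?w x * c \<le> ?w x * ?H x"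
    proof (cases "x \<in> A")
      case True
      then show ?thesis using H[OF True] nn by (simp add: mult_left_mono)
    next
      case False
      then show ?thesis using nn by simp
    qed
    \<comment> \<open>The overlap density is at most \<open>p i\<close> and at most
      \<open>p (i - 1)\<close>; each within-block term receives the density of its own
      level.\<close>
    also have "\<dots> \<le> p i x * block_dev m g i x + ?w x * (g (x, i) - g (x, i - 1))\<^sup>2 + p (i - 1) x * block_dev m g (i - 1) x"
      unfolding distrib_left using nn by (intro add_mono mult_right_mono order_refl) auto
    finally have "ennreal (indicator A x * ?w x * c) \<le> ennreal (p i x * block_dev m g i x + ?w x * (g (x, i) - g (x, i - 1))\<^sup>2 + p (i - 1) x * block_dev m g (i - 1) x)"
      by (rule ennreal_leI)
    then show "ennreal (indicator A x * ?w x) * ennreal c \<le> ennreal (p i x * block_dev m g i x)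
      + ennreal (?w x * (g (x, i) - g (x, i - 1))\<^sup>2) + ennreal (p (i - 1) x * block_dev m g (i - 1) x)"
      using nn by (simp add: c_def ennreal_mult''[symmetric] flip: ennreal_plus)
  qed
  also have "\<dots> = within_dev m g i + level_dev g i + within_dev m g (i - 1)"
    unfolding within_dev_def level_dev_def
    by (subst nn_integral_add, measurable, subst nn_integral_add, measurable)
  also have "\<dots> \<le> ennreal s" by (rule s)
  finally have "w * c \<le> s" using s(1) by simp
  then have "(m i A - m (i - 1) B)\<^sup>2 \<le> 3 * s / w" using w(1) by (simp add: c_def field_simps)
  then show ?thesis using B by blast
qed

section \<open>Descent to level 1 and the variance\<close>

lemma chain_to_base:
  assumes c: "\<And>i. i \<in> {2..L} \<Longrightarrow> 0 \<le> c i"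
    and step: "\<And>i A. i \<in> {2..L} \<Longrightarrow> A \<in> Part i \<Longrightarrow> \<exists>B\<in>Part (i - 1). (m i A - m (i - 1) B)\<^sup>2 \<le> (c i :: real)"
    and i: "i \<in> {1..L}" and A: "A \<in> Part i"
  shows "(m i A - m 1 \<Omega>)\<^sup>2 \<le> (real L - 1) * (\<Sum>j\<in>{2..L}. c j)"
proof -
  \<comment> \<open>Distances, unlike their squares, add up along the descent. The induction start 0
    is vacuous, and level 1 has only the block \<Omega>.\<close>
  have abs: "i \<in> {1..L} \<Longrightarrow> A \<in> Part i \<Longrightarrow> \<bar>m i A - m 1 \<Omega>\<bar> \<le> (\<Sum>j\<in>{2..i}. sqrt (c j))" for i A
  proof (induction i arbitrary: A)
    case (Suc i)
    show ?case
    proof (cases "i = 0")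
      case True
      then show ?thesis using Suc.prems part_1 by simp
    next
      case False
      then have i: "Suc i \<in> {2..L}" "i \<in> {1..L}" using Suc.prems by auto
      from step[OF i(1) Suc.prems(2)] obtain B where B: "B \<in> Part i" "(m (Suc i) A - m i B)\<^sup>2 \<le> c (Suc i)" by auto
      have "\<bar>m (Suc i) A - m i B\<bar> \<le> sqrt (c (Suc i))"
        using B(2) by (metis real_sqrt_abs real_sqrt_le_iff)
      moreover have "\<bar>m i B - m 1 \<Omega>\<bar> \<le> (\<Sum>j\<in>{2..i}. sqrt (c j))" by (rule Suc.IH[OF i(2) B(1)])
      moreover have "(\<Sum>j\<in>{2..Suc i}. sqrt (c j)) = (\<Sum>j\<in>{2..i}. sqrt (c j)) + sqrt (c (Suc i))"
        using i by (simp add: sum.nat_ivl_Suc')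
      ultimately show ?thesis by linarith
    qed
  qed simp
  have "\<bar>m i A - m 1 \<Omega>\<bar> \<le> (\<Sum>j\<in>{2..i}. sqrt (c j))" by (rule abs[OF i A])
  \<comment> \<open>Extending the sum to all levels makes the bound the same for every
    block.\<close>
  also have "\<dots> \<le> (\<Sum>j\<in>{2..L}. sqrt (c j))" using i c by (intro sum_mono2) auto
  finally have "(m i A - m 1 \<Omega>)\<^sup>2 \<le> (\<Sum>j\<in>{2..L}. sqrt (c j))\<^sup>2"
    using power_mono[of "\<bar>m i A - m 1 \<Omega>\<bar>" _ 2] by simp
  also have "\<dots> \<le> (\<Sum>j\<in>{2..L}. (sqrt (c j))\<^sup>2) * card {2..L}" by (rule sum_squared_le_sum_of_squares)
  also have "(\<Sum>j\<in>{2..L}. (sqrt (c j))\<^sup>2) = (\<Sum>j\<in>{2..L}. c j)" using c by (intro sum.cong) auto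
  also have "real (card {2..L}) = real L - 1" using L by (simp add: of_nat_diff)
  finally show ?thesis by (simp add: mult.commute)
qed

text \<open>The deviation is split at the centre of a block containing x. The within-block part is
  bounded with r k \<le> 1, while the part with M keeps its weights, whose sum 1 avoids a factor
  L.\<close>

lemma variance_st_le:
  assumes g: "L2 st (st_density p r) g" and M: "0 \<le> M"
    and means: "\<And>i A. i \<in> {1..L} \<Longrightarrow> A \<in> Part i \<Longrightarrow> (m i A - c)\<^sup>2 \<le> M"
  shows "ennreal (var_pi st (st_density p r) g) \<le> 2 * (\<Sum>k\<in>{1..L}. within_dev m g k) + ennreal (2 * M)"
proof -
  have gm[measurable]: "g \<in> borel_measurable st" using g by (simp add: L2_def)
  have "ennreal (var_pi st (st_density p r) g) \<le> (\<integral>\<^sup>+z. ennreal (st_density p r z * (g z - c)\<^sup>2) \<partial>st)"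
    by (rule var_pi_eq(2)[OF prob_density_st g])
  also have "\<dots> = (\<Sum>k\<in>{1..L}. \<integral>\<^sup>+x. ennreal (st_density p r (x, k) * (g (x, k) - c)\<^sup>2) \<partial>mu)"
    by (rule nn_integral_st) measurable
  also have "\<dots> \<le> (\<Sum>k\<in>{1..L}. 2 * within_dev m g k + ennreal (2 * M) * ennreal (r k))"
  proof (rule sum_mono)
    fix k assume k: "k \<in> {1..L}"
    note [measurable] = p_measurable[OF k] block_dev_measurable[OF gm k]
    have rk: "0 < r k" "r k \<le> 1"
      using r_pos[OF k] member_le_sum[OF k, of r] r_pos r_sum by (auto simp: less_imp_le)
    have "(\<integral>\<^sup>+x. ennreal (st_density p r (x, k) * (g (x, k) - c)\<^sup>2) \<partial>mu)
      \<le> (\<integral>\<^sup>+x. 2 * ennreal (p k x * block_dev m g k x) + ennreal (2 * M * r k) * ennreal (p k x) \<partial>mu)"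
    proof (rule nn_integral_mono)
      fix x assume "x \<in> space mu"
      then have x: "x \<in> \<Omega>" by simp
      obtain A where A: "A \<in> Part k" "x \<in> A" using Part_cover[OF k x] by blast
      note nn = p_nonneg[OF k x] block_dev_nonneg[of m g k x]
      have "(g (x, k) - c)\<^sup>2 \<le> 2 * (g (x, k) - m k A)\<^sup>2 + 2 * (m k A - c)\<^sup>2"
        using zero_le_power2[of "(g (x, k) - m k A) - (m k A - c)"] by (simp add: power2_eq_square algebra_simps)
      also have "\<dots> \<le> 2 * block_dev m g k x + 2 * M"
        using block_dev_ge[OF k A, of g m] means[OF k A(1)] by simp
      finally have "r k * p k x * (g (x, k) - c)\<^sup>2 \<le> r k * p k x * (2 * block_dev m g k x + 2 * M)"
        using rk nn by (intro mult_left_mono) auto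
      also have "\<dots> = r k * (2 * (p k x * block_dev m g k x)) + 2 * M * r k * p k x" by (simp add: algebra_simps)
      also have "\<dots> \<le> 2 * (p k x * block_dev m g k x) + 2 * M * r k * p k x"
        using rk nn by (intro add_right_mono mult_left_le_one_le) auto
      finally have "ennreal (r k * p k x * (g (x, k) - c)\<^sup>2) \<le> ennreal (2 * (p k x * block_dev m g k x) + 2 * M * r k * p k x)"
        by (rule ennreal_leI)
      also have "\<dots> = 2 * ennreal (p k x * block_dev m g k x) + ennreal (2 * M * r k) * ennreal (p k x)"
      proof -
        have "ennreal (2 * (p k x * block_dev m g k x)) = 2 * ennreal (p k x * block_dev m g k x)"
          using ennreal_mult'[of 2 "p k x * block_dev m g k x"] by simp
        moreover have "ennreal (2 * M * r k * p k x) = ennreal (2 * M * r k) * ennreal (p k x)"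
          using M rk by (intro ennreal_mult') simp
        ultimately show ?thesis using nn M rk by (subst ennreal_plus) auto
      qed
      finally show "ennreal (st_density p r (x, k) * (g (x, k) - c)\<^sup>2)
         \<le> 2 * ennreal (p k x * block_dev m g k x) + ennreal (2 * M * r k) * ennreal (p k x)"
        by (simp add: st_density_def)
    qed
    also have "\<dots> = 2 * within_dev m g k + ennreal (2 * M * r k)"
      unfolding within_dev_def
      by (subst nn_integral_add, measurable, subst nn_integral_cmult, measurable, subst nn_integral_cmult, measurable)
        (simp add: prob_densityD(5)[OF dens[OF k]])
    also have "ennreal (2 * M * r k) = ennreal (2 * M) * ennreal (r k)" using M by (intro ennreal_mult') simp
    finally show "(\<integral>\<^sup>+x. ennreal (st_density p r (x, k) * (g (x, k) - c)\<^sup>2) \<partial>mu)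
      \<le> 2 * within_dev m g k + ennreal (2 * M) * ennreal (r k)" .
  qed
  also have "\<dots> = 2 * (\<Sum>k\<in>{1..L}. within_dev m g k) + ennreal (2 * M) * (\<Sum>k\<in>{1..L}. ennreal (r k))"
    by (simp only: sum.distrib sum_distrib_left)
  finally show ?thesis by (simp only: sum_r_ennreal mult_1_right)
qed

text \<open>The 48 is 2 * 3 * 8: 2 from splitting the variance, 3 from
  \<open>close_block_below\<close>, and 8 from the common bound 8 L e on both costs, which also
  gives the factor L. The factor L - 1 is the Cauchy-Schwarz loss over the descent. The summand 4
  pays for the within-block part of the variance.\<close>

lemma poincare_st:
  assumes g: "L2 st (st_density p r) g"
    and \<gamma>: "0 < \<gamma>" "\<And>i A. i \<in> {1..L} \<Longrightarrow> A \<in> Part i \<Longrightarrow> \<gamma> \<le> restricted_gap mu (p i) (P i) A"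
    and w: "0 < w" "w \<le> 1"
      "\<And>i A. i \<in> {2..L} \<Longrightarrow> A \<in> Part i \<Longrightarrow> w \<le> (\<integral>x. indicator A x * min (p (i - 1) x) (p i x) \<partial>lborel)"
    and \<rho>: "0 < \<rho>" "\<And>i. i \<in> {1..L} \<Longrightarrow> \<rho> \<le> r i"
  shows "w * \<gamma> * \<rho> * var_pi st (st_density p r) g
     \<le> (48 * real L * (real L - 1) + 4) * dirichlet_form st (st_density p r) K g"
proof -
  define e where "e = dirichlet_form st (st_density p r) K g"
  have gm: "g \<in> borel_measurable st" using g by (simp add: L2_def)
  note en = energy_eq_dirichlet_form[OF markov_kernel_st prob_density_st nn_stationary_st g]
  have e0: "0 \<le> e" using en(2) by (simp add: e_def)
  have L1: "1 \<le> real L" using L by simp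
  have "1 \<in> {1..L}" "\<Omega> \<in> Part 1" using L part_1 by auto
  then have \<gamma>2: "\<gamma> \<le> 2" using \<gamma> by (intro restricted_gap_le_2) auto
  obtain m where m: "\<And>i. i \<in> {1..L} \<Longrightarrow> ennreal (2 * \<gamma>) * within_dev m g i \<le> energy mu (p i) (P i) (\<lambda>x. g (x, i))"
    using within_dev_le_energy[OF g less_imp_le[OF \<gamma>(1)] \<gamma>(2)] by blast
  have tot: "(\<Sum>k\<in>{1..L}. ennreal (\<rho> * \<gamma>) * within_dev m g k) + (\<Sum>k\<in>{2..L}. ennreal (\<rho> / (2 * real L)) * level_dev g k)
      \<le> ennreal (2 * e)" (is "?S1 + ?S2 \<le> _")
    using energy_st_ge_devs[OF gm less_imp_le[OF \<gamma>(1)] m \<rho>] en(1) by (simp add: e_def)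
  \<comment> \<open>\<open>enn2real\<close> loses nothing here: the costs are finite because their
    sum with positive coefficients is at most 2 e. Positivity of \<gamma> and \<rho> enters at this
    point.\<close>
  define v where "v k = enn2real (within_dev m g k)" for k
  define d where "d k = enn2real (level_dev g k)" for k
  have S1: "?S1 \<le> ennreal (2 * e)" and S2: "?S2 \<le> ennreal (2 * e)"
    using tot by (auto intro: order_trans[rotated] add_increasing add_increasing2)
  have v: "within_dev m g k = ennreal (v k)" if k: "k \<in> {1..L}" for k
  proof -
    have "ennreal (\<rho> * \<gamma>) * within_dev m g k \<le> ?S1"
      by (rule member_le_sum[OF k, of "\<lambda>k. ennreal (\<rho> * \<gamma>) * within_dev m g k"]) auto
    also have "\<dots> \<le> ennreal (2 * e)" by (rule S1)
    finally have "ennreal (\<rho> * \<gamma>) * within_dev m g k < \<top>" by (rule le_less_trans) simp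
    then have "within_dev m g k < \<top>" using \<rho>(1) \<gamma>(1) by (auto simp: ennreal_mult_less_top)
    then show ?thesis by (simp add: v_def)
  qed
  have d: "level_dev g k = ennreal (d k)" if k: "k \<in> {2..L}" for k
  proof -
    have "ennreal (\<rho> / (2 * real L)) * level_dev g k \<le> ?S2"
      by (rule member_le_sum[OF k, of "\<lambda>k. ennreal (\<rho> / (2 * real L)) * level_dev g k"]) auto
    also have "\<dots> \<le> ennreal (2 * e)" by (rule S2)
    finally have "ennreal (\<rho> / (2 * real L)) * level_dev g k < \<top>" by (rule le_less_trans) simp
    then have "level_dev g k < \<top>" using \<rho>(1) L by (auto simp: ennreal_mult_less_top)
    then show ?thesis by (simp add: d_def)
  qed
  have v0: "0 \<le> v k" and d0: "0 \<le> d k" for k by (simp_all add: v_def d_def)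
  define V where "V = (\<Sum>k\<in>{1..L}. v k)"
  define D where "D = (\<Sum>k\<in>{2..L}. d k)"
  have V0: "0 \<le> V" and D0: "0 \<le> D" using v0 d0 by (auto simp: V_def D_def intro: sum_nonneg)
  have VD: "\<rho> * \<gamma> * V + \<rho> / (2 * real L) * D \<le> 2 * e"
  proof -
    have "?S1 = ennreal (\<rho> * \<gamma> * V)"
    proof -
      have "?S1 = (\<Sum>k\<in>{1..L}. ennreal (\<rho> * \<gamma> * v k))"
        using \<rho>(1) \<gamma>(1) v0 by (intro sum.cong refl) (simp only: v ennreal_mult mult_nonneg_nonneg less_imp_le)
      also have "\<dots> = ennreal (\<Sum>k\<in>{1..L}. \<rho> * \<gamma> * v k)"
        using \<rho>(1) \<gamma>(1) v0 by (intro sum_ennreal) simp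
      finally show ?thesis by (simp add: V_def sum_distrib_left)
    qed
    moreover have "?S2 = ennreal (\<rho> / (2 * real L) * D)"
    proof -
      have "?S2 = (\<Sum>k\<in>{2..L}. ennreal (\<rho> / (2 * real L) * d k))"
        using \<rho>(1) d0 by (intro sum.cong refl) (simp only: d ennreal_mult divide_nonneg_nonneg mult_nonneg_nonneg zero_le_numeral of_nat_0_le_iff less_imp_le)
      also have "\<dots> = ennreal (\<Sum>k\<in>{2..L}. \<rho> / (2 * real L) * d k)"
        using \<rho>(1) d0 by (intro sum_ennreal) simp
      finally show ?thesis by (simp add: D_def sum_distrib_left)
    qed
    ultimately have "ennreal (\<rho> * \<gamma> * V + \<rho> / (2 * real L) * D) \<le> ennreal (2 * e)"
      using tot \<rho>(1) \<gamma>(1) V0 D0 by (subst ennreal_plus) simp_all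
    then show ?thesis using e0 by (subst (asm) ennreal_le_iff) simp_all
  qed
  define s where "s i = v i + d i + v (i - 1)" for i
  have s0: "0 \<le> s i" for i using v0 d0 by (simp add: s_def)
  define M where "M = (real L - 1) * (\<Sum>j\<in>{2..L}. 3 * s j / w)"
  have M0: "0 \<le> M" using L1 s0 w(1) by (auto simp: M_def intro!: mult_nonneg_nonneg sum_nonneg)
  \<comment> \<open>A level can be the upper end of one step and the lower end of another, hence 2 V
    but only one D.\<close>
  have sum_s: "(\<Sum>j\<in>{2..L}. s j) \<le> 2 * V + D"
  proof -
    have "(\<Sum>j\<in>{2..L}. v j) \<le> V" unfolding V_def using v0 by (intro sum_mono2) auto
    moreover have "(\<Sum>j\<in>{2..L}. v (j - 1)) \<le> V"
    proof -
      have "(\<Sum>j\<in>{2..L}. v (j - 1)) = (\<Sum>k\<in>(\<lambda>j. j - 1) ` {2..L}. v k)"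
        by (subst sum.reindex) (auto simp: inj_on_def)
      also have "\<dots> \<le> V" unfolding V_def using v0 by (intro sum_mono2) auto
      finally show ?thesis .
    qed
    ultimately show ?thesis by (simp add: s_def D_def sum.distrib)
  qed
  have means: "(m i A - m 1 \<Omega>)\<^sup>2 \<le> M" if i: "i \<in> {1..L}" and A: "A \<in> Part i" for i A
    unfolding M_def
  proof (rule chain_to_base[OF _ _ i A])
    show "0 \<le> 3 * s j / w" for j using s0 w(1) by simp
    fix j B assume j: "j \<in> {2..L}" and B: "B \<in> Part j"
    have "within_dev m g j + level_dev g j + within_dev m g (j - 1) = ennreal (s j)"
    proof -
      have "j \<in> {1..L}" "j - 1 \<in> {1..L}" using j by auto
      then show ?thesis using v0 d0 by (simp only: v d[OF j] s_def ennreal_plus add_nonneg_nonneg)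
    qed
    then show "\<exists>B'\<in>Part (j - 1). (m j B - m (j - 1) B')\<^sup>2 \<le> 3 * s j / w"
      by (intro close_block_below[OF gm j B w(1) w(3)[OF j B] s0]) simp
  qed
  have var: "var_pi st (st_density p r) g \<le> 2 * V + 2 * M"
  proof -
    have "ennreal (var_pi st (st_density p r) g) \<le> 2 * (\<Sum>k\<in>{1..L}. within_dev m g k) + ennreal (2 * M)"
      by (rule variance_st_le[OF g M0 means])
    also have "(\<Sum>k\<in>{1..L}. within_dev m g k) = ennreal V"
      unfolding V_def using v v0 by (subst sum_ennreal[symmetric]) (auto intro!: sum.cong)
    also have "2 * ennreal V + ennreal (2 * M) = ennreal (2 * V + 2 * M)"
      using V0 M0 by (simp add: ennreal_mult)
    finally show ?thesis using V0 M0 by (subst (asm) ennreal_le_iff) simp_all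
  qed
  have wM: "w * M \<le> (real L - 1) * (3 * (2 * V + D))"
  proof -
    have "w * M = (real L - 1) * (3 * (\<Sum>j\<in>{2..L}. s j))"
      using w(1) by (simp add: M_def flip: sum_divide_distrib sum_distrib_left)
    also have "\<dots> \<le> (real L - 1) * (3 * (2 * V + D))"
      using sum_s L1 by (intro mult_left_mono) auto
    finally show ?thesis .
  qed
  have A1: "\<gamma> * \<rho> * V \<le> 2 * e"
    using VD \<rho>(1) D0 L1 by (smt (verit) mult.commute divide_nonneg_nonneg mult_nonneg_nonneg)
  \<comment> \<open>Multiplying \<open>VD\<close> by 4 L leaves the coefficient 2 \<rho> at D, which
    covers \<gamma> \<rho> because \<gamma> \<le> 2; at V it leaves 4 L \<gamma> \<rho>, more than
    the 2 \<gamma> \<rho> required.\<close>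
  have A2: "\<gamma> * \<rho> * (2 * V + D) \<le> 8 * real L * e"
  proof -
    have "\<gamma> * \<rho> * (2 * V) \<le> 4 * real L * (\<rho> * \<gamma> * V)"
      using mult_right_mono[of 2 "4 * real L" "\<rho> * \<gamma> * V"] L1 \<rho>(1) \<gamma>(1) V0 by (simp add: ac_simps)
    moreover have "\<gamma> * \<rho> * D \<le> 2 * (\<rho> * D)"
      using mult_right_mono[OF \<gamma>2, of "\<rho> * D"] \<rho>(1) D0 by (simp add: mult.assoc)
    moreover have "4 * real L * (\<rho> / (2 * real L) * D) = 2 * (\<rho> * D)" using L1 by simp
    moreover have "4 * real L * (\<rho> * \<gamma> * V + \<rho> / (2 * real L) * D) \<le> 4 * real L * (2 * e)"
      using VD L1 by (intro mult_left_mono) auto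
    ultimately show ?thesis unfolding distrib_left by linarith
  qed
  have "w * \<gamma> * \<rho> * var_pi st (st_density p r) g \<le> w * \<gamma> * \<rho> * (2 * V + 2 * M)"
    using var w(1) \<gamma>(1) \<rho>(1) by (intro mult_left_mono) auto
  also have "\<dots> = w * (2 * (\<gamma> * \<rho> * V)) + 2 * (\<gamma> * \<rho>) * (w * M)" by (simp add: algebra_simps)
  also have "\<dots> \<le> 1 * (2 * (2 * e)) + 2 * (\<gamma> * \<rho>) * ((real L - 1) * (3 * (2 * V + D)))"
  proof (rule add_mono)
    show "w * (2 * (\<gamma> * \<rho> * V)) \<le> 1 * (2 * (2 * e))"
    proof (rule mult_mono)
      show "2 * (\<gamma> * \<rho> * V) \<le> 2 * (2 * e)" using A1 by linarith
    qed (use w V0 \<gamma>(1) \<rho>(1) in simp_all)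
    show "2 * (\<gamma> * \<rho>) * (w * M) \<le> 2 * (\<gamma> * \<rho>) * ((real L - 1) * (3 * (2 * V + D)))"
      by (rule mult_left_mono[OF wM]) (use \<gamma>(1) \<rho>(1) in simp)
  qed
  also have "\<dots> = 4 * e + 6 * (real L - 1) * (\<gamma> * \<rho> * (2 * V + D))" by (simp add: algebra_simps)
  also have "\<dots> \<le> 4 * e + 6 * (real L - 1) * (8 * real L * e)"
    using A2 L1 by (intro add_left_mono mult_left_mono) auto
  also have "\<dots> = (48 * real L * (real L - 1) + 4) * e" by (simp add: algebra_simps)
  finally show ?thesis by (simp add: e_def)
qed

end

section \<open>From the Poincare inequality to the stated constants\<close>

theorem mainTheorem1:
  fixes \<Omega> :: "'a::euclidean_space set" and L :: nat
    and P :: "nat \<Rightarrow> 'a \<Rightarrow> 'a measure" and p :: "nat \<Rightarrow> 'a \<Rightarrow> real"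
    and r :: "nat \<Rightarrow> real" and Part :: "nat \<Rightarrow> 'a set set"
  assumes "\<Omega> \<in> sets lborel" and "L \<ge> 1"
    and "\<forall>i\<in>{1..L}. markov_kernel (state_space \<Omega>) (P i)"
    and "\<forall>i\<in>{1..L}. prob_density (state_space \<Omega>) (p i)"
    and "\<forall>i\<in>{1..L}. stationary (state_space \<Omega>) (p i) (P i)"
    and "\<forall>i\<in>{1..L}. reversible (state_space \<Omega>) (p i) (P i)"
    and "\<forall>i\<in>{1..L}. r i > 0" and "(\<Sum>i\<in>{1..L}. r i) = 1"
    and "\<forall>i\<in>{1..L}. is_partition \<Omega> (Part i)"
    and "\<forall>i\<in>{1..L}. \<forall>A\<in>Part i. mass lborel (p i) A > 0"
    and "Part 1 = {\<Omega>}"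
  defines "rr \<equiv> Min (r ` {1..L}) / Max (r ` {1..L})"
    and "\<delta> \<equiv> Min (insert 1 {(\<integral>x. indicator A x * min (p (i - 1) x) (p i x) \<partial>lborel) / mass lborel (p i) A
                       | i A. 1 < i \<and> i \<le> L \<and> A \<in> Part i})"
    and "pmin \<equiv> Min {mass lborel (p i) A | i A. i \<in> {1..L} \<and> A \<in> Part i}"
  shows "spectral_gap (st_space \<Omega> L) (st_density p r) (st_kernel \<Omega> L P p r)
           \<ge> rr ^ 4 * \<delta>\<^sup>2 * pmin\<^sup>2 / (32 * real L ^ 4)
             * Min {restricted_gap (state_space \<Omega>) (p i) (P i) A | i A. i \<in> {1..L} \<and> A \<in> Part i}"
proof -
  interpret tempering_partition \<Omega> L P p r Part
    by unfold_locales (use assms in auto)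
  have 1: "1 \<in> {1..L}" "\<Omega> \<in> Part 1" using L part_1 by auto
  have fin: "finite {f i A | i A. i \<in> {1..L} \<and> A \<in> Part i}" for f :: "nat \<Rightarrow> 'a set \<Rightarrow> real"
  proof -
    have "{f i A | i A. i \<in> {1..L} \<and> A \<in> Part i} = (\<lambda>(i, A). f i A) ` (SIGMA i:{1..L}. Part i)" by force
    then show ?thesis using finite_Part by (simp only:) (intro finite_imageI finite_SigmaI, auto)
  qed
  let ?o = "\<lambda>i A. (\<integral>x. indicator A x * min (p (i - 1) x) (p i x) \<partial>lborel) / mass lborel (p i) A"
  let ?D = "{?o i A | i A. 1 < i \<and> i \<le> L \<and> A \<in> Part i}"
  have finD: "finite ?D"
  proof (rule finite_subset[OF _ fin[of ?o]])
    have "i \<in> {1..L}" if "1 < i" "i \<le> L" for i using that by simp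
    then show "?D \<subseteq> {?o i A | i A. i \<in> {1..L} \<and> A \<in> Part i}" by blast
  qed
  have o0: "0 \<le> ?o i A" if i: "1 < i" "i \<le> L" and A: "A \<in> Part i" for i A
  proof -
    have k: "i \<in> {1..L}" "i - 1 \<in> {1..L}" using i by auto
    have "0 \<le> (\<integral>x. indicator A x * min (p (i - 1) x) (p i x) \<partial>lborel)"
    proof (rule integral_nonneg_AE, rule AE_I2)
      fix x
      show "0 \<le> indicator A x * min (p (i - 1) x) (p i x)"
        using Part_subset[OF k(1) A] p_nonneg[OF k(1), of x] p_nonneg[OF k(2), of x]
        by (auto split: split_indicator)
    qed
    then show ?thesis using part_pos[OF k(1) A] by simp
  qed
  \<comment> \<open>The inserted 1 gives \<delta> a value for L = 1, where there is no overlap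
    quotient, and yields \<delta> \<le> 1 at once.\<close>
  have \<delta>: "0 \<le> \<delta>" "\<delta> \<le> 1"
    unfolding \<delta>_def using finD o0 by (auto simp: Min_ge_iff intro!: Min_le)
  have \<delta>_le: "\<delta> \<le> ?o i A" if "1 < i" "i \<le> L" "A \<in> Part i" for i A
    unfolding \<delta>_def using finD that by (intro Min_le) auto
  let ?m = "{mass lborel (p i) A | i A. i \<in> {1..L} \<and> A \<in> Part i}"
  have pmin_le: "pmin \<le> mass lborel (p i) A" if "i \<in> {1..L}" "A \<in> Part i" for i A
    unfolding pmin_def using that by (intro Min_le fin) blast
  have "pmin \<in> ?m" unfolding pmin_def using 1 by (intro Min_in fin) blast
  then have pmin: "0 < pmin" "pmin \<le> 1" using part_pos mass_le_1 by auto
  define \<rho> where "\<rho> = Min (r ` {1..L})"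
  define R where "R = Max (r ` {1..L})"
  have \<rho>_le: "\<rho> \<le> r i" and R_ge: "r i \<le> R" if "i \<in> {1..L}" for i using that by (auto simp: \<rho>_def R_def)
  have "\<rho> \<in> r ` {1..L}" unfolding \<rho>_def using 1 by (intro Min_in) auto
  then have \<rho>: "0 < \<rho>" using r_pos by auto
  have R: "\<rho> \<le> R" using \<rho>_le[OF 1(1)] R_ge[OF 1(1)] by simp
  \<comment> \<open>The largest weight is at least the average 1 / L. This is what exchanges \<rho>
    for rr, as rr = \<rho> / R \<le> L \<rho>.\<close>
  have LR: "1 \<le> real L * R"
    using sum_bounded_above[of "{1..L}" r R] R_ge r_sum by simp
  have L1: "1 \<le> real L" using L by simp
  have rr_eq: "rr = \<rho> / R" by (simp add: rr_def \<rho>_def R_def)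
  have rr: "0 \<le> rr" "rr \<le> 1" "rr \<le> real L * \<rho>"
  proof -
    show "0 \<le> rr" "rr \<le> 1" using \<rho> R by (auto simp: rr_eq)
    have "\<rho> * 1 \<le> \<rho> * (real L * R)" using \<rho> LR by (intro mult_left_mono) auto
    then show "rr \<le> real L * \<rho>" using \<rho> R by (simp add: rr_eq field_simps)
  qed
  define \<gamma> where "\<gamma> = Min {restricted_gap (state_space \<Omega>) (p i) (P i) A | i A. i \<in> {1..L} \<and> A \<in> Part i}"
  have \<gamma>_le: "\<gamma> \<le> restricted_gap mu (p i) (P i) A" if "i \<in> {1..L}" "A \<in> Part i" for i A
    unfolding \<gamma>_def using that by (intro Min_le fin) blast
  define c where "c = rr ^ 4 * \<delta>\<^sup>2 * pmin\<^sup>2 / (32 * real L ^ 4)"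
  have c0: "0 \<le> c" by (simp add: c_def)
  have main: "c * \<gamma> \<le> dirichlet_form st (st_density p r) K g / var_pi st (st_density p r) g"
    if g: "L2 st (st_density p r) g" and var: "0 < var_pi st (st_density p r) g" for g
  proof (cases "0 < \<gamma> \<and> 0 < \<delta>")
    \<comment> \<open>If the smallest restricted gap or the overlap fails to be positive, the
      claimed bound is at most 0 and the Dirichlet form is nonnegative.\<close>
    case False
    then have "\<gamma> \<le> 0 \<or> \<delta> = 0" using \<delta> by auto
    then have "\<gamma> \<le> 0 \<or> c = 0" by (auto simp: c_def)
    then have "c * \<gamma> \<le> 0" using c0 by (auto simp: mult_nonneg_nonpos)
    moreover have "0 \<le> dirichlet_form st (st_density p r) K g / var_pi st (st_density p r) g"
      using energy_eq_dirichlet_form(2)[OF markov_kernel_st prob_density_st nn_stationary_st g] var by simp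
    ultimately show ?thesis by linarith
  next
    case True
    let ?E = "dirichlet_form st (st_density p r) K g" and ?V = "var_pi st (st_density p r) g"
    have E0: "0 \<le> ?E" by (rule energy_eq_dirichlet_form(2)[OF markov_kernel_st prob_density_st nn_stationary_st g])
    have w: "\<delta> * pmin \<le> (\<integral>x. indicator A x * min (p (i - 1) x) (p i x) \<partial>lborel)"
      if i: "i \<in> {2..L}" and A: "A \<in> Part i" for i A
    proof -
      have k: "i \<in> {1..L}" using i by auto
      have "\<delta> * pmin \<le> \<delta> * mass lborel (p i) A" using pmin_le[OF k A] \<delta> by (intro mult_left_mono)
      also have "\<dots> \<le> (\<integral>x. indicator A x * min (p (i - 1) x) (p i x) \<partial>lborel)"
        using \<delta>_le[of i A] i A part_pos[OF k A] by (simp add: pos_le_divide_eq)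
      finally show ?thesis .
    qed
    have "\<delta> * pmin * \<gamma> * \<rho> * ?V \<le> (48 * real L * (real L - 1) + 4) * ?E"
      using True pmin \<delta> \<rho> by (intro poincare_st[OF g _ \<gamma>_le _ _ w _ \<rho>_le]) (auto intro: mult_le_one)
    \<comment> \<open>The extra factor L is the one in rr \<le> L \<rho>; even with it the constant
      of \<open>poincare_st\<close> stays below 32 L^4.\<close>
    then have "real L * (\<delta> * pmin * \<gamma> * \<rho> * ?V) \<le> real L * ((48 * real L * (real L - 1) + 4) * ?E)"
      using L1 by (intro mult_left_mono) auto
    also have "\<dots> = real L * (48 * real L * (real L - 1) + 4) * ?E" by simp
    also have "\<dots> \<le> 32 * real L ^ 4 * ?E"
    proof (rule mult_right_mono[OF _ E0])
      \<comment> \<open>Substituting L = t + 1 turns the difference into a product with nonnegative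
        coefficients in t.\<close>
      define t where "t = real L - 1"
      have t: "real L = t + 1" "0 \<le> t" using L1 by (auto simp: t_def)
      have "32 * real L ^ 4 - real L * (48 * real L * (real L - 1) + 4) = (t + 1) * (32 * t ^ 3 + 48 * t\<^sup>2 + 48 * t + 28)"
        unfolding t(1) by (simp add: power2_eq_square power3_eq_cube power4_eq_xxxx algebra_simps)
      also have "\<dots> \<ge> 0" using t(2) by simp
      finally show "real L * (48 * real L * (real L - 1) + 4) \<le> 32 * real L ^ 4" by simp
    qed
    finally have b: "real L * \<rho> * (\<delta> * pmin * (\<gamma> * ?V)) \<le> 32 * real L ^ 4 * ?E" by (simp add: ac_simps)
    \<comment> \<open>All three factors lie in [0, 1], so lowering the exponents can only increase
      the product.\<close>
    have "rr ^ 4 * \<delta>\<^sup>2 * pmin\<^sup>2 * (\<gamma> * ?V) \<le> rr * \<delta> * pmin * (\<gamma> * ?V)"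
    proof (intro mult_right_mono mult_mono)
      show "rr ^ 4 \<le> rr" using power_decreasing[of 1 4 rr] rr by simp
      show "\<delta>\<^sup>2 \<le> \<delta>" using power_decreasing[of 1 2 \<delta>] \<delta> by simp
      show "pmin\<^sup>2 \<le> pmin" using power_decreasing[of 1 2 pmin] pmin by simp
    qed (use rr \<delta> pmin True var in auto)
    also have "\<dots> = rr * (\<delta> * pmin * (\<gamma> * ?V))" by simp
    also have "\<dots> \<le> real L * \<rho> * (\<delta> * pmin * (\<gamma> * ?V))"
      using rr(3) \<delta> pmin True var by (intro mult_right_mono) auto
    also note b
    finally have "c * (\<gamma> * ?V) \<le> ?E"
      using L1 by (simp add: c_def field_simps)
    then show ?thesis using var by (simp add: pos_le_divide_eq mult.assoc)
  qed
  \<comment> \<open>A common lower bound passes to a real \<open>Inf\<close> only if the set is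
    nonempty; a nonzero vector b supplies the test function that shows this.\<close>
  obtain b :: 'a where b: "b \<noteq> 0" using nonzero_Basis SOME_Basis by blast
  have "c * \<gamma> \<le> spectral_gap st (st_density p r) K"
    unfolding spectral_gap_def
  proof (rule cInf_greatest)
    show "{dirichlet_form st (st_density p r) K g / var_pi st (st_density p r) g |g.
        L2 st (st_density p r) g \<and> 0 < var_pi st (st_density p r) g} \<noteq> {}"
      using arctan_inner_st[OF b] by blast
  qed (use main in blast)
  then show ?thesis by (simp only: c_def \<gamma>_def)
qed

end
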